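(* Let $X$ be an uncountable compact metric space with $\dim_{\mathrm H}X=0$, and let $C(X)$ be the Banach space of real-valued continuous functions on $X$ with the supremum norm. Then the set $$\{f\in C(X) : \dim_{\mathrm H}G_f=1\}$$ is a 1-prevalent subset of $C(X)$. If, in addition, $\dim_{\mathrm P}X=0$, then the set $$\{f\in C(X) : \dim_{\mathrm H}G_f=\dim_{\mathrm P}G_f=1\}$$ is a 1-prevalent subset of $C(X)$.
   Context: $\dim_{\mathrm H}$ and $\dim_{\mathrm P}$ denote Hausdorff and packing dimension. $G_f=\{(x,f(x)) : x\in X\}\subseteq X\times\mathbb{R}$ is the graph of $f$, with the metric induced by any of the natural equivalent product metrics on $X\times\mathbb{R}$ (e.g. the maximum metric). 1-prevalence: Let $Y$ be a Banach space. A one-dimensional subspace $P = \{\lambda \Phi : \lambda\in\mathbb{R}\}\subseteq Y$ (with $\Phi \in Y$, $\Phi\neq 0$) is called a probe for a Borel set $F \subseteq Y$ if $\mathcal{L}_P\big(Y\setminus (F+y)\big)=0$ for all $y\in Y$, where $\mathcal{L}_P = \mathcal{L}^1\circ\pi_P^{-1}$ is the push forward of one-dimensional Lebesgue measure $\mathcal{L}^1$ under $\pi_P:\mathbb{R}\to P$, $\pi_P(\lambda)=\lambda\Phi$ (regarded as a measure on $Y$ concentrated on $P$). A Borel set $F\subseteq Y$ is 1-prevalent if it admits a one-dimensional probe. A non-Borel set is called 1-prevalent if it contains a 1-prevalent Borel set. *)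

theory Defs
  imports "HOL-Analysis.Analysis"
begin

section \<open>Hausdorff dimension\<close>

text \<open>
  Both \<open>hausdorff_pre\<close> and \<open>packing_pre\<close> are only used for exponents \<open>s > 0\<close>, where
  \<open>0 powr s = 0\<close> is the intended value; \<open>0 powr 0 = 0\<close> would be wrong for nonempty sets.
  Boundedness of the covering sets is required explicitly because \<open>diameter\<close> is real-valued
  and carries no information on unbounded sets.
\<close>

definition hausdorff_pre :: "real \<Rightarrow> real \<Rightarrow> 'a::metric_space set \<Rightarrow> ennreal" where
  "hausdorff_pre s \<delta> A =
     (INF U \<in> {U :: nat \<Rightarrow> 'a set. A \<subseteq> (\<Union>i. U i) \<and> (\<forall>i. bounded (U i) \<and> diameter (U i) \<le> \<delta>)}.
        \<Sum>i. ennreal (diameter (U i) powr s))"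

definition hausdorff_measure :: "real \<Rightarrow> 'a::metric_space set \<Rightarrow> ennreal" where
  "hausdorff_measure s A = (SUP \<delta> \<in> {0<..}. hausdorff_pre s \<delta> A)"

definition hausdorff_dim :: "'a::metric_space set \<Rightarrow> ennreal" where
  "hausdorff_dim A = Inf {ennreal s | s. 0 < s \<and> hausdorff_measure s A = 0}"


section \<open>Packing dimension\<close>

text \<open>
  A \<open>\<delta>\<close>-packing of \<open>A\<close> is a countable family of disjoint closed balls centred in \<open>A\<close> with radii
  at most \<open>\<delta>\<close>, given here as a set of pairs (centre, radius). Balls are weighted by \<open>2 * r\<close> and
  not by their diameter, which in a general metric space may be much smaller than \<open>2 * r\<close>.
\<close>

definition packings :: "real \<Rightarrow> 'a::metric_space set \<Rightarrow> ('a \<times> real) set set" where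
  "packings \<delta> A =
     {C. countable C \<and> C \<subseteq> A \<times> {0<..\<delta>} \<and> disjoint_family_on (\<lambda>(x, r). cball x r) C}"

definition packing_pre :: "real \<Rightarrow> real \<Rightarrow> 'a::metric_space set \<Rightarrow> ennreal" where
  "packing_pre s \<delta> A = (SUP C \<in> packings \<delta> A. \<Sum>\<^sub>\<infinity>(x, r)\<in>C. ennreal ((2 * r) powr s))"

definition packing_premeasure :: "real \<Rightarrow> 'a::metric_space set \<Rightarrow> ennreal" where
  "packing_premeasure s A = (INF \<delta> \<in> {0<..}. packing_pre s \<delta> A)"

text \<open>The premeasure is not countably subadditive, hence the second infimum over covers.\<close>

definition packing_measure :: "real \<Rightarrow> 'a::metric_space set \<Rightarrow> ennreal" where
  "packing_measure s A =
     (INF E \<in> {E :: nat \<Rightarrow> 'a set. A \<subseteq> (\<Union>i. E i)}. \<Sum>i. packing_premeasure s (E i))"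

definition packing_dim :: "'a::metric_space set \<Rightarrow> ennreal" where
  "packing_dim A = Inf {ennreal s | s. 0 < s \<and> packing_measure s A = 0}"


section \<open>1-prevalence\<close>

definition line_measure :: "'b::banach \<Rightarrow> 'b measure" where
  "line_measure \<Phi> = distr lborel borel (\<lambda>t. t *\<^sub>R \<Phi>)"

text \<open>The probe is the line spanned by \<open>\<Phi>\<close>.\<close>

definition is_probe :: "'b::banach \<Rightarrow> 'b set \<Rightarrow> bool" where
  "is_probe \<Phi> F \<longleftrightarrow>
     \<Phi> \<noteq> 0 \<and> (\<forall>y. emeasure (line_measure \<Phi>) (UNIV - (\<lambda>x. x + y) ` F) = 0)"

definition one_prevalent :: "'b::banach set \<Rightarrow> bool" where
  "one_prevalent F \<longleftrightarrow> (\<exists>B \<in> sets borel. B \<subseteq> F \<and> (\<exists>\<Phi>. is_probe \<Phi> B))"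

text \<open>
  For Borel sets \<open>one_prevalent\<close> says that the set itself admits a probe, so the definition
  covers the Borel and the non-Borel case at once.
\<close>

lemma translate_in_borel:
  fixes F :: "'b::banach set"
  assumes "F \<in> sets borel"
  shows "(\<lambda>x. x + y) ` F \<in> sets borel"
proof -
  have "(\<lambda>x. x + y) ` F = (\<lambda>x. x - y) -` F \<inter> space borel"
    by (auto simp: image_iff intro!: bexI[of _ "_ - y"])
  moreover have "(\<lambda>x. x - y) \<in> borel_measurable borel"
    by (intro borel_measurable_continuous_onI continuous_intros)
  ultimately show ?thesis
    using assms by (metis measurable_sets)
qed

lemma one_prevalent_borel_iff:
  fixes F :: "'b::banach set"
  assumes F: "F \<in> sets borel"
  shows "one_prevalent F \<longleftrightarrow> (\<exists>\<Phi>. is_probe \<Phi> F)"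
proof
  assume "one_prevalent F"
  then obtain B \<Phi> where B: "B \<in> sets borel" "B \<subseteq> F" and \<Phi>: "is_probe \<Phi> B"
    unfolding one_prevalent_def by blast
  have "emeasure (line_measure \<Phi>) (UNIV - (\<lambda>x. x + y) ` F) = 0" for y
  proof -
    have "emeasure (line_measure \<Phi>) (UNIV - (\<lambda>x. x + y) ` F)
        \<le> emeasure (line_measure \<Phi>) (UNIV - (\<lambda>x. x + y) ` B)"
    proof (rule emeasure_mono)
      show "UNIV - (\<lambda>x. x + y) ` F \<subseteq> UNIV - (\<lambda>x. x + y) ` B"
        using B(2) by blast
      have "- (\<lambda>x. x + y) ` B \<in> sets borel"
        using translate_in_borel[OF B(1)] by (rule borel_comp)
      then show "UNIV - (\<lambda>x. x + y) ` B \<in> sets (line_measure \<Phi>)"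
        by (simp add: line_measure_def Compl_eq_Diff_UNIV)
    qed
    also have "\<dots> = 0"
      using \<Phi> by (simp add: is_probe_def)
    finally show ?thesis by simp
  qed
  then show "\<exists>\<Phi>. is_probe \<Phi> F"
    using \<Phi> unfolding is_probe_def by blast
qed (use F in \<open>auto simp: one_prevalent_def\<close>)


section \<open>Graphs of continuous functions\<close>

text \<open>
  On a compact space every continuous function is bounded, so there \<open>'a \<Rightarrow>\<^sub>C real\<close> with its
  supremum norm is the Banach space of all continuous functions. The library metric on
  \<open>'a \<times> real\<close> is the Euclidean product metric.
\<close>

instance bcontfun :: (metric_space, banach) banach ..

definition graph_of :: "('a::metric_space \<Rightarrow>\<^sub>C real) \<Rightarrow> ('a \<times> real) set" where
  "graph_of f = {(x, apply_bcontfun f x) | x. x \<in> UNIV}"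

end

theory Submission
  imports Defs "HOL-Probability.Probability_Measure"
begin

text \<open>
  The upper bounds come from \<open>dim (X \<times> [-M, M]) \<le> dim X + 1\<close>, for both dimensions. For the lower
  bound, a Cantor scheme in \<open>X\<close> yields a continuous \<open>\<Phi> : X \<rightarrow> [0, 1]\<close> and a Borel
  probability measure \<open>\<mu>\<close> on \<open>X\<close> whose image under \<open>\<Phi>\<close> is Lebesgue measure on \<open>[0, 1)\<close>. For
  \<open>s < 1\<close> the integral of \<open>\<bar>a + t b\<bar> powr (-s)\<close> over bounded \<open>t\<close> is at most a constant times
  \<open>\<bar>b\<bar> powr (-s)\<close>; hence, integrating first over \<open>t\<close>, the image of \<open>\<mu>\<close> under \<open>f + t \<Phi>\<close> has finite
  Riesz \<open>s\<close>-energy for almost every \<open>t\<close>, and then the graph of \<open>f + t \<Phi>\<close> has Hausdorff dimension at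
  least \<open>s\<close>. Finiteness of these energies is a Borel condition on the function by lower
  semicontinuity, and the packing dimension is squeezed between the Hausdorff dimension and 1.
\<close>

subsection \<open>Hausdorff measure\<close>

text \<open>The energies see only the heights \<open>f x\<close>: two points of a graph are at least
  as far apart as their heights, so it suffices to control how the heights are distributed. The
  probe has to serve every translate at once. This works because in \<open>a + t * b\<close>, with
  \<open>a\<close> a difference of values of \<open>f\<close>, the number \<open>a\<close> only
  moves the singularity of the kernel along the \<open>t\<close>-axis; the bound does not depend on
  it, so \<open>f\<close> drops out and only the energy of \<Phi> remains. That energy is the one of
  Lebesgue measure on \<open>[0, 1)\<close>, which is finite for every \<open>s < 1\<close>. The
  measure is not assembled generation by generation on a Cantor set: a Borel right inverse
  \<open>g\<close> of \<Phi> over \<open>[0, 1)\<close> is built, and Lebesgue measure is pushed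
  forward along \<open>g\<close>. The functions whose graph has dimension at least 1 are not shown
  to form a Borel set; the probe is tested on a smaller Borel set, where the energies for a sequence
  of exponents increasing to 1 are all finite. So a single \<Phi> handles all exponents, at the cost
  of countably many null sets of \<open>t\<close>.\<close>

lemma diameter_le_dist:
  assumes "0 \<le> d" "\<And>x y. x \<in> S \<Longrightarrow> y \<in> S \<Longrightarrow> dist x y \<le> d"
  shows "diameter S \<le> d"
  using assms by (auto simp: diameter_def intro: cSUP_least)

lemma bounded_if_dist_le:
  assumes "\<And>x y. x \<in> S \<Longrightarrow> y \<in> S \<Longrightarrow> dist x y \<le> d"
  shows "bounded S"
  using assms unfolding bounded_def by blast

lemma hausdorff_pre_mono:
  assumes "A \<subseteq> B" "\<delta>' \<le> \<delta>"
  shows "hausdorff_pre s \<delta> A \<le> hausdorff_pre s \<delta>' B"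
  unfolding hausdorff_pre_def
  by (rule INF_superset_mono) (use assms in \<open>auto intro: order_trans\<close>)

lemma hausdorff_pre_le:
  assumes "A \<subseteq> (\<Union>i. U i)" "\<And>i. bounded (U i)" "\<And>i. diameter (U i) \<le> \<delta>"
  shows "hausdorff_pre s \<delta> A \<le> (\<Sum>i. ennreal (diameter (U i) powr s))"
  unfolding hausdorff_pre_def by (rule INF_lower) (use assms in auto)

lemma hausdorff_pre_less:
  assumes "hausdorff_pre s \<delta> A < c"
  obtains U where "A \<subseteq> (\<Union>i. U i)" "\<And>i. bounded (U i)" "\<And>i. diameter (U i) \<le> \<delta>"
    "(\<Sum>i. ennreal (diameter (U i) powr s)) < c"
  using assms unfolding hausdorff_pre_def by (auto simp: INF_less_iff)

lemma hausdorff_measure_eq_0_iff: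
  "hausdorff_measure s A = 0 \<longleftrightarrow> (\<forall>\<delta>>0. hausdorff_pre s \<delta> A = 0)"
  unfolding hausdorff_measure_def bot_ennreal[symmetric] SUP_bot_conv by auto

lemma hausdorff_pre_subadditive:
  "hausdorff_pre s \<delta> (\<Union>n. A n) \<le> (\<Sum>n::nat. hausdorff_pre s \<delta> (A n))"
proof (rule ennreal_le_epsilon)
  fix e :: real
  assume "0 < e" and fin: "(\<Sum>n. hausdorff_pre s \<delta> (A n)) < top"
  have "\<exists>U. A n \<subseteq> (\<Union>i. U i) \<and> (\<forall>i. bounded (U i) \<and> diameter (U i) \<le> \<delta>) \<and>
     (\<Sum>i. ennreal (diameter (U i) powr s)) < hausdorff_pre s \<delta> (A n) + e * (1/2)^Suc n" for n
  proof -
    have "hausdorff_pre s \<delta> (A n) < hausdorff_pre s \<delta> (A n) + e * (1/2)^Suc n"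
      using fin \<open>0 < e\<close> by (auto simp add: less_top dest!: ennreal_suminf_lessD)
    then show ?thesis
      by (elim hausdorff_pre_less) blast
  qed
  then obtain U where U: "\<And>n. A n \<subseteq> (\<Union>i. U n i)" "\<And>n i. bounded (U n i)"
    "\<And>n i. diameter (U n i) \<le> \<delta>"
    "\<And>n. (\<Sum>i. ennreal (diameter (U n i) powr s)) < hausdorff_pre s \<delta> (A n) + e * (1/2)^Suc n"
    by metis
  define V where "V k = (case prod_decode k of (n, i) \<Rightarrow> U n i)" for k
  have "hausdorff_pre s \<delta> (\<Union>n. A n) \<le> (\<Sum>k. ennreal (diameter (V k) powr s))"
  proof (rule hausdorff_pre_le)
    show "(\<Union>n. A n) \<subseteq> (\<Union>k. V k)"
    proof safe
      fix n x
      assume "x \<in> A n"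
      then obtain i where "x \<in> U n i" using U(1) by blast
      then have "x \<in> V (prod_encode (n, i))" by (simp add: V_def)
      then show "x \<in> (\<Union>k. V k)" by blast
    qed
  qed (auto simp: V_def U split: prod.split)
  also have "\<dots> = (\<Sum>k. (\<lambda>(n, i). ennreal (diameter (U n i) powr s)) (prod_decode k))"
    by (simp add: V_def case_prod_beta)
  also have "\<dots> = (\<Sum>n. \<Sum>i. ennreal (diameter (U n i) powr s))"
    by (rule suminf_ennreal_2dimen) simp
  also have "\<dots> \<le> (\<Sum>n. hausdorff_pre s \<delta> (A n) + e * (1/2)^Suc n)"
    by (intro suminf_le less_imp_le U) auto
  also have "\<dots> = (\<Sum>n. hausdorff_pre s \<delta> (A n)) + (\<Sum>n. ennreal (e * (1/2)^Suc n))"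
    by (rule suminf_add[symmetric]) auto
  also have "(\<Sum>n. ennreal (e * (1/2)^Suc n)) = ennreal e"
    using \<open>0 < e\<close> sums_mult[OF power_half_series, of e]
    by (subst suminf_ennreal_eq[of _ e]) auto
  finally show "hausdorff_pre s \<delta> (\<Union>n. A n) \<le> (\<Sum>n. hausdorff_pre s \<delta> (A n)) + ennreal e" .
qed

lemma hausdorff_pre_finite_cover:
  assumes A: "A \<subseteq> (\<Union>j<N. V j)" and V: "\<And>j x y. j < N \<Longrightarrow> x \<in> V j \<Longrightarrow> y \<in> V j \<Longrightarrow> dist x y \<le> d"
    and d: "0 \<le> d" "d \<le> \<delta>" and s: "0 < s"
  shows "hausdorff_pre s \<delta> A \<le> ennreal (real N * d powr s)"
proof -
  \<comment> \<open>Padding with empty sets costs nothing: their diameter is 0, and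
    \<open>0 powr s = 0\<close>.\<close>
  define U where "U j = (if j < N then V j else {})" for j
  have dist: "dist x y \<le> d" if "x \<in> U j" "y \<in> U j" for j x y
    using that V by (auto simp: U_def split: if_splits)
  have bnd: "bounded (U j)" and diam: "diameter (U j) \<le> d" for j
    using dist d(1) by (auto intro!: bounded_if_dist_le diameter_le_dist)
  have "hausdorff_pre s \<delta> A \<le> (\<Sum>j. ennreal (diameter (U j) powr s))"
    using A by (intro hausdorff_pre_le bnd order_trans[OF diam d(2)]) (auto simp: U_def)
  also have "\<dots> = (\<Sum>j<N. ennreal (diameter (U j) powr s))"
    by (intro suminf_finite) (auto simp: U_def)
  also have "\<dots> \<le> (\<Sum>j<N. ennreal (d powr s))"
    by (intro sum_mono ennreal_leI powr_mono2 diam diameter_ge_0 bnd) (use s in auto)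
  also have "\<dots> = ennreal (real N * d powr s)"
    by (simp add: ennreal_mult' ennreal_of_nat_eq_real_of_nat)
  finally show ?thesis .
qed

lemma hausdorff_measure_zero_mono:
  assumes "hausdorff_measure s A = 0" "s \<le> t"
  shows "hausdorff_measure t A = 0"
  unfolding hausdorff_measure_eq_0_iff
proof (intro allI impI)
  fix \<delta> :: real
  assume "0 < \<delta>"
  \<comment> \<open>Raising the exponent decreases \<open>diameter powr s\<close> only for diameters
    at most 1.\<close>
  define \<eta> where "\<eta> = min \<delta> 1"
  have \<eta>: "0 < \<eta>" "\<eta> \<le> 1" "\<eta> \<le> \<delta>" using \<open>0 < \<delta>\<close> by (auto simp: \<eta>_def)
  have "hausdorff_pre t \<eta> A \<le> hausdorff_pre s \<eta> A"
    unfolding hausdorff_pre_def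
  proof (intro INF_mono)
    fix U :: "nat \<Rightarrow> 'a set"
    assume U: "U \<in> {U. A \<subseteq> (\<Union>i. U i) \<and> (\<forall>i. bounded (U i) \<and> diameter (U i) \<le> \<eta>)}"
    have "(\<Sum>i. ennreal (diameter (U i) powr t)) \<le> (\<Sum>i. ennreal (diameter (U i) powr s))"
    proof (intro suminf_le ennreal_leI powr_mono' assms)
      fix i
      show "0 \<le> diameter (U i)" using U by (auto intro: diameter_ge_0)
      show "diameter (U i) \<le> 1" using U \<eta>(2) by (auto intro: order_trans)
    qed auto
    with U show "\<exists>V\<in>{U. A \<subseteq> (\<Union>i. U i) \<and> (\<forall>i. bounded (U i) \<and> diameter (U i) \<le> \<eta>)}.
        (\<Sum>i. ennreal (diameter (V i) powr t)) \<le> (\<Sum>i. ennreal (diameter (U i) powr s))"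
      by blast
  qed
  moreover have "hausdorff_pre s \<eta> A = 0"
    using assms(1) \<eta>(1) unfolding hausdorff_measure_eq_0_iff by blast
  moreover have "hausdorff_pre t \<delta> A \<le> hausdorff_pre t \<eta> A"
    by (intro hausdorff_pre_mono \<eta>) simp
  ultimately show "hausdorff_pre t \<delta> A = 0"
    by (metis le_zero_eq order_trans)
qed

text \<open>A set of diameter at most \<open>d\<close> times an interval splits into about \<open>1 / d\<close> pieces of diameter \<open>2 d\<close>.\<close>

lemma hausdorff_pre_times_interval:
  fixes U :: "'a::metric_space set"
  assumes U: "\<And>x y. x \<in> U \<Longrightarrow> y \<in> U \<Longrightarrow> dist x y \<le> d" and d: "0 < d" "d \<le> 1" "2 * d \<le> \<delta>"
    and s: "0 < s" "s \<le> 1" and M: "0 \<le> (M::real)"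
  shows "hausdorff_pre (1 + s) \<delta> (U \<times> {-M..M}) \<le> ennreal (4 * (2 * M + 1) * d powr s)"
proof -
  \<comment> \<open>The intervals of length \<open>d\<close> are counted from \<open>-M\<close>; the
    \<open>+ 1\<close> gives the endpoint \<open>t = M\<close>, of index
    \<open>\<lfloor>2 * M / d\<rfloor>\<close>, its own interval.\<close>
  define N where "N = nat \<lfloor>2 * M / d\<rfloor> + 1"
  define V where "V j = U \<times> {-M + real j * d .. -M + (real j + 1) * d}" for j
  have "hausdorff_pre (1 + s) \<delta> (U \<times> {-M..M}) \<le> ennreal (real N * (2 * d) powr (1 + s))"
  proof (rule hausdorff_pre_finite_cover)
    show "U \<times> {-M..M} \<subseteq> (\<Union>j<N. V j)"
    proof safe
      fix x t
      assume xt: "x \<in> U" "t \<in> {-M..M}"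
      define j where "j = nat \<lfloor>(t + M) / d\<rfloor>"
      have ge: "0 \<le> (t + M) / d" using xt d by auto
      have "real j \<le> (t + M) / d" "(t + M) / d < real j + 1"
        using ge by (auto simp: j_def)
      then have "t \<in> {-M + real j * d .. -M + (real j + 1) * d}"
        using d by (auto simp: field_simps)
      moreover have "j < N"
        unfolding j_def N_def using xt d ge
        by (auto intro!: le_imp_less_Suc nat_mono floor_mono divide_right_mono)
      ultimately show "(x, t) \<in> (\<Union>j<N. V j)" using xt by (auto simp: V_def)
    qed
    fix j p q
    assume "p \<in> V j" "q \<in> V j"
    then have "dist (fst p) (fst q) \<le> d" "dist (snd p) (snd q) \<le> d"
      using U by (auto simp: V_def dist_real_def field_simps)
    moreover have "dist p q \<le> dist (fst p) (fst q) + dist (snd p) (snd q)"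
      unfolding dist_prod_def by (rule sqrt_sum_squares_le_sum) auto
    ultimately show "dist p q \<le> 2 * d" by simp
  qed (use d s in auto)
  \<comment> \<open>\<open>d \<le> 1\<close> absorbs the extra interval into
    \<open>(2 * M + 1) / d\<close>, and \<open>s \<le> 1\<close> gives
    \<open>2 powr (1 + s) \<le> 4\<close>. The division by \<open>d\<close> lowers the exponent from
    \<open>1 + s\<close> to \<open>s\<close>.\<close>
  also have "real N * (2 * d) powr (1 + s) \<le> ((2 * M + 1) / d) * (4 * d powr (1 + s))"
  proof (rule mult_mono)
    have "real N \<le> 2 * M / d + 1"
      unfolding N_def using d M by simp
    also have "\<dots> \<le> (2 * M + 1) / d" using d by (simp add: field_simps)
    finally show "real N \<le> (2 * M + 1) / d" .
    have "(2::real) powr (1 + s) \<le> 2 powr 2" using s by (intro powr_mono) auto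
    then show "(2 * d) powr (1 + s) \<le> 4 * d powr (1 + s)"
      using d by (auto simp: powr_mult intro!: mult_right_mono)
  qed (use d M in auto)
  also have "\<dots> = 4 * (2 * M + 1) * d powr s"
    using d by (simp add: powr_add)
  finally show ?thesis by (simp add: ennreal_leI)
qed

lemma hausdorff_measure_times_interval_eq_0:
  fixes A :: "'a::metric_space set"
  assumes A: "hausdorff_measure s A = 0" and s: "0 < s" "s \<le> 1" and M: "0 \<le> (M::real)"
  shows "hausdorff_measure (1 + s) (A \<times> {-M..M}) = 0"
  unfolding hausdorff_measure_eq_0_iff
proof (intro allI impI)
  fix \<delta> :: real
  assume "0 < \<delta>"
  define \<eta> where "\<eta> = min (\<delta> / 2) 1"
  have \<eta>: "0 < \<eta>" "\<eta> \<le> 1" "2 * \<eta> \<le> \<delta>" using \<open>0 < \<delta>\<close> by (auto simp: \<eta>_def)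
  define C where "C = 4 * (2 * M + 1)"
  have "C > 0" using M by (simp add: C_def)
  \<comment> \<open>One \<open>e\<close> pays for the cover of \<open>A\<close>, the other for
    enlarging its sets to the sizes \<open>d i\<close>.\<close>
  have bound: "hausdorff_pre (1 + s) \<delta> (A \<times> {-M..M}) \<le> ennreal (C * 2 * e)" if e: "0 < e" for e :: real
  proof -
    have "hausdorff_pre s \<eta> A < ennreal e"
      using A \<eta> e unfolding hausdorff_measure_eq_0_iff by simp
    then obtain U where U: "A \<subseteq> (\<Union>i. U i)" "\<And>i. bounded (U i)" "\<And>i. diameter (U i) \<le> \<eta>"
      "(\<Sum>i. ennreal (diameter (U i) powr s)) < ennreal e"
      by (rule hausdorff_pre_less) blast
    text \<open>The pieces of diameter 0 are given a small positive size, so that one can divide by it.\<close>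
    define d where "d i = max (diameter (U i)) (min \<eta> ((e * (1/2)^Suc i) powr (1 / s)))" for i
    have d: "0 < d i" "d i \<le> \<eta>" "diameter (U i) \<le> d i" for i
      using \<eta> U(3)[of i] e by (auto simp: d_def less_max_iff_disj)
    have ds: "d i powr s \<le> diameter (U i) powr s + e * (1/2)^Suc i" for i
    proof (cases "d i = diameter (U i)")
      case False
      then have "d i \<le> (e * (1/2)^Suc i) powr (1 / s)" by (auto simp: d_def max_def split: if_splits)
      then have "d i powr s \<le> ((e * (1/2)^Suc i) powr (1 / s)) powr s"
        using d s by (intro powr_mono2) (auto intro: less_imp_le)
      also have "\<dots> = e * (1/2)^Suc i" using e s by (simp add: powr_powr)
      finally show ?thesis by (simp add: add_increasing)
    qed (use e in auto)
    have "hausdorff_pre (1 + s) \<delta> (A \<times> {-M..M}) \<le> hausdorff_pre (1 + s) \<delta> (\<Union>i. U i \<times> {-M..M})"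
      using U(1) by (intro hausdorff_pre_mono) auto
    also have "\<dots> \<le> (\<Sum>i. hausdorff_pre (1 + s) \<delta> (U i \<times> {-M..M}))"
      by (rule hausdorff_pre_subadditive)
    also have "\<dots> \<le> (\<Sum>i. ennreal (C * d i powr s))"
      unfolding C_def
    proof (intro suminf_le hausdorff_pre_times_interval)
      fix i x y
      assume "x \<in> U i" "y \<in> U i"
      then show "dist x y \<le> d i"
        using diameter_bounded_bound[OF U(2)] d(3) by (meson order_trans)
    next
      fix i
      show "d i \<le> 1" "2 * d i \<le> \<delta>" using d(2)[of i] \<eta> by auto
    qed (use d s M in auto)
    also have "\<dots> \<le> (\<Sum>i. ennreal C * (ennreal (diameter (U i) powr s) + ennreal (e * (1/2)^Suc i)))"
      using ds \<open>C > 0\<close> e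
      by (intro suminf_le) (auto simp flip: ennreal_plus ennreal_mult simp del: power_Suc intro!: ennreal_leI)
    also have "\<dots> = ennreal C * ((\<Sum>i. ennreal (diameter (U i) powr s)) + (\<Sum>i. ennreal (e * (1/2)^Suc i)))"
      by (simp add: suminf_add del: power_Suc)
    also have "(\<Sum>i. ennreal (e * (1/2)^Suc i)) = ennreal e"
      using e sums_mult[OF power_half_series, of e] by (subst suminf_ennreal_eq[of _ e]) auto
    also have "ennreal C * ((\<Sum>i. ennreal (diameter (U i) powr s)) + ennreal e) \<le> ennreal C * (ennreal e + ennreal e)"
      using U(4) by (intro mult_left_mono add_right_mono) auto
    also have "\<dots> = ennreal (C * 2 * e)"
      using e \<open>C > 0\<close> by (simp flip: ennreal_plus ennreal_mult)
    finally show ?thesis .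
  qed
  have "hausdorff_pre (1 + s) \<delta> (A \<times> {-M..M}) \<le> 0"
  proof (rule ennreal_le_epsilon)
    fix e :: real
    assume "0 < e"
    then show "hausdorff_pre (1 + s) \<delta> (A \<times> {-M..M}) \<le> 0 + ennreal e"
      using bound[of "e / (C * 2)"] \<open>C > 0\<close> by simp
  qed
  then show "hausdorff_pre (1 + s) \<delta> (A \<times> {-M..M}) = 0" by simp
qed

subsection \<open>Packing measure\<close>

text \<open>Multiplication by a positive finite constant is an order isomorphism of
  \<open>ennreal\<close>. This moves constants past the two nested infima in the packing
  measure.\<close>

lemma le_cmult_INF_ennreal:
  fixes f :: "'i \<Rightarrow> ennreal"
  assumes "0 < c" "\<And>i. i \<in> I \<Longrightarrow> x \<le> ennreal c * f i"
  shows "x \<le> ennreal c * (INF i\<in>I. f i)"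
proof -
  have inv: "ennreal c * (ennreal (inverse c) * y) = y" "ennreal (inverse c) * (ennreal c * y) = y" for y
    using assms(1) by (simp_all add: mult.assoc[symmetric] flip: ennreal_mult)
  have "ennreal (inverse c) * x \<le> (INF i\<in>I. f i)"
    by (intro INF_greatest) (metis assms(2) inv(2) mult_left_mono zero_le)
  then show ?thesis by (metis inv(1) mult_left_mono zero_le)
qed

lemma packings_subset:
  "C \<in> packings \<delta> A \<Longrightarrow> F \<subseteq> C \<Longrightarrow> F \<in> packings \<delta> A"
  unfolding packings_def by (auto intro: countable_subset disjoint_family_on_mono)

text \<open>A sum of nonnegative terms is the supremum of its finite partial sums, and each finite
  part of a packing is again a packing. Estimates then need only finite families.\<close>

lemma packing_pre_eq_SUP_finite:
  "packing_pre s \<delta> A =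
     (SUP F \<in> {F \<in> packings \<delta> A. finite F}. \<Sum>(x, r)\<in>F. ennreal ((2 * r) powr s))"
proof (rule antisym)
  show "packing_pre s \<delta> A \<le> (SUP F \<in> {F \<in> packings \<delta> A. finite F}. \<Sum>(x, r)\<in>F. ennreal ((2 * r) powr s))"
    unfolding packing_pre_def
  proof (rule SUP_least)
    fix C
    assume "C \<in> packings \<delta> A"
    then show "(\<Sum>\<^sub>\<infinity>(x, r)\<in>C. ennreal ((2 * r) powr s))
        \<le> (SUP F \<in> {F \<in> packings \<delta> A. finite F}. \<Sum>(x, r)\<in>F. ennreal ((2 * r) powr s))"
      by (subst nonneg_infsum_complete)
        (auto intro!: SUP_subset_mono intro: packings_subset)
  qed
  show "(SUP F \<in> {F \<in> packings \<delta> A. finite F}. \<Sum>(x, r)\<in>F. ennreal ((2 * r) powr s)) \<le> packing_pre s \<delta> A"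
    unfolding packing_pre_def
    by (intro SUP_mono) (metis (mono_tags, lifting) infsum_finite mem_Collect_eq order_refl)
qed

lemma packing_pre_ge:
  assumes "F \<in> packings \<delta> A" "finite F"
  shows "(\<Sum>(x, r)\<in>F. ennreal ((2 * r) powr s)) \<le> packing_pre s \<delta> A"
  unfolding packing_pre_eq_SUP_finite by (rule SUP_upper) (use assms in auto)

lemma packing_pre_mono:
  assumes "A \<subseteq> B" "\<delta> \<le> \<delta>'"
  shows "packing_pre s \<delta> A \<le> packing_pre s \<delta>' B"
  unfolding packing_pre_def packings_def
  by (rule SUP_subset_mono) (use assms in \<open>fastforce+\<close>)

lemma packing_premeasure_le_pre: "0 < \<delta> \<Longrightarrow> packing_premeasure s A \<le> packing_pre s \<delta> A"
  unfolding packing_premeasure_def by (rule INF_lower) simp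

lemma packing_measure_mono:
  assumes "A \<subseteq> B"
  shows "packing_measure s A \<le> packing_measure s B"
  unfolding packing_measure_def by (rule INF_superset_mono) (use assms in auto)

text \<open>
  For each height \<open>t\<close>, the balls of a packing of \<open>A \<times> {-M..M}\<close> whose centre is within half a radius
  of height \<open>t\<close> project to a packing of \<open>A\<close> with halved radii. Integrating over \<open>t\<close> gives the bound.
\<close>

lemma packing_pre_times_interval:
  fixes A :: "'a::metric_space set"
  assumes \<delta>: "0 < \<delta>" "\<delta> \<le> 1" and M: "0 \<le> M"
  shows "packing_pre (1 + s) \<delta> (A \<times> {-M..M})
    \<le> ennreal (2 powr (1 + s) * (2 * M + 2)) * packing_pre s (\<delta> / 2) A"
  unfolding packing_pre_eq_SUP_finite[of "1 + s"]
proof (rule SUP_least)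
  fix F :: "(('a \<times> real) \<times> real) set"
  assume "F \<in> {F \<in> packings \<delta> (A \<times> {-M..M}). finite F}"
  then have fin: "finite F" and sub: "F \<subseteq> (A \<times> {-M..M}) \<times> {0<..\<delta>}"
    and disj: "disjoint_family_on (\<lambda>(x, r). cball x r) F"
    by (auto simp: packings_def)
  define J :: "(('a \<times> real) \<times> real) \<Rightarrow> real set"
    where "J = (\<lambda>((x, u), r). {u - r / 2 .. u + r / 2})"
  define h where "h = (\<lambda>((x :: 'a, u :: real), r :: real). (x, r / 2))"
  have J_meas [measurable]: "J p \<in> sets borel" for p
    by (auto simp: J_def split: prod.split)
  \<comment> \<open>Radii are at most 1 and centres have height in \<open>{-M..M}\<close>, so no
    \<open>J p\<close> leaves \<open>{-M - 1..M + 1}\<close>. Recording this keeps the integral over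
    \<open>t\<close> finite.\<close>
  have slice: "(\<Sum>p\<in>F. ennreal (snd p powr s) * indicator (J p) t)
      \<le> packing_pre s (\<delta> / 2) A * indicator {-M - 1..M + 1} t" for t
  proof -
    define G where "G = {p \<in> F. t \<in> J p}"
    have G_disj: "cball (fst (h p)) (snd (h p)) \<inter> cball (fst (h q)) (snd (h q)) = {}"
      if "p \<in> G" "q \<in> G" "p \<noteq> q" for p q
    proof (rule ccontr)
      assume "\<not> ?thesis"
      then obtain z where z: "z \<in> cball (fst (h p)) (snd (h p))" "z \<in> cball (fst (h q)) (snd (h q))"
        by blast
      \<comment> \<open>A point common to two halved balls, lifted to height \<open>t\<close>, would
        lie in both original balls: the horizontal and the vertical offset are each at most half a
        radius.\<close>
      have "(z, t) \<in> cball (fst p) (snd p)" if "p \<in> G" "z \<in> cball (fst (h p)) (snd (h p))" for p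
      proof -
        obtain x u r where p: "p = ((x, u), r)" by (metis prod.exhaust)
        have "u - r / 2 \<le> t" "t \<le> u + r / 2" and z: "dist x z \<le> r / 2"
          using that unfolding p by (auto simp: h_def G_def J_def)
        then have "dist u t \<le> r / 2"
          unfolding dist_real_def by linarith
        with z have le: "dist x z + dist u t \<le> r / 2 + r / 2" by (rule add_mono)
        have "dist (x, u) (z, t) \<le> dist x z + dist u t"
          unfolding dist_Pair_Pair by (rule sqrt_sum_squares_le_sum) auto
        also have "\<dots> \<le> r / 2 + r / 2"
          by (rule le)
        finally show ?thesis by (simp add: p)
      qed
      then have "(z, t) \<in> cball (fst p) (snd p) \<inter> cball (fst q) (snd q)" using that z by blast
      moreover have "cball (fst p) (snd p) \<inter> cball (fst q) (snd q) = {}"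
        using disjoint_family_onD[OF disj, of p q] that by (auto simp: G_def case_prod_beta)
      ultimately show False by blast
    qed
    have r_pos: "0 < snd p" "snd p \<le> \<delta>" if "p \<in> F" for p
      using sub that by auto
    have inj: "inj_on h G"
    proof (rule inj_onI, rule ccontr)
      fix p q
      assume pq: "p \<in> G" "q \<in> G" "h p = h q" "p \<noteq> q"
      have "fst (h p) \<in> cball (fst (h p)) (snd (h p))"
        using r_pos[of p] pq(1) by (auto simp: h_def G_def split: prod.split)
      with G_disj[OF pq(1,2,4)] pq(3) show False by simp
    qed
    have "h ` G \<in> packings (\<delta> / 2) A"
      unfolding packings_def
    proof (intro CollectI conjI)
      show "countable (h ` G)" using fin by (intro countable_finite) (auto simp: G_def)
      show "h ` G \<subseteq> A \<times> {0<..\<delta> / 2}"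
        using sub by (fastforce simp: h_def G_def)
      show "disjoint_family_on (\<lambda>(x, r). cball x r) (h ` G)"
        using G_disj unfolding disjoint_family_on_def case_prod_beta by blast
    qed
    then have "(\<Sum>(x, r)\<in>h ` G. ennreal ((2 * r) powr s)) \<le> packing_pre s (\<delta> / 2) A"
      using fin by (intro packing_pre_ge) (auto simp: G_def)
    \<comment> \<open>The halved radius cancels the factor 2 in the weight of a ball.\<close>
    also have "(\<Sum>(x, r)\<in>h ` G. ennreal ((2 * r) powr s)) = (\<Sum>p\<in>G. ennreal (snd p powr s))"
      by (subst sum.reindex[OF inj]) (simp add: h_def case_prod_beta o_def del: sum_ennreal)
    finally have le: "(\<Sum>p\<in>G. ennreal (snd p powr s)) \<le> packing_pre s (\<delta> / 2) A" .
    have eq: "(\<Sum>p\<in>F. ennreal (snd p powr s) * indicator (J p) t) = (\<Sum>p\<in>G. ennreal (snd p powr s))"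
      unfolding G_def sum.inter_filter[OF fin] by (intro sum.cong) (auto simp: indicator_def)
    show ?thesis
    proof (cases "t \<in> {-M - 1..M + 1}")
      case True
      then show ?thesis using le eq by simp
    next
      case False
      have "G = {}"
      proof (rule ccontr)
        assume "G \<noteq> {}"
        then obtain x u r where "((x, u), r) \<in> G" by fastforce
        then have "u \<in> {-M..M}" "r \<le> 1" "t \<in> {u - r / 2 .. u + r / 2}"
          using sub \<delta> by (auto simp: G_def J_def)
        with False show False by auto
      qed
      then show ?thesis unfolding eq by simp
    qed
  qed
  \<comment> \<open>\<open>J p\<close> has length exactly the radius, so integrating its indicator
    supplies the additional power of \<open>r\<close>.\<close>
  have "(\<Sum>((x, u), r)\<in>F. ennreal (r powr (1 + s))) =
      (\<Sum>p\<in>F. \<integral>\<^sup>+t. ennreal (snd p powr s) * indicator (J p) t \<partial>lborel)"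
  proof (intro sum.cong refl)
    fix p
    assume "p \<in> F"
    then obtain x u r where p: "p = ((x, u), r)" "0 < r"
      using sub by auto
    have "(\<integral>\<^sup>+t. ennreal (snd p powr s) * indicator (J p) t \<partial>lborel)
        = ennreal (r powr s) * emeasure lborel {u - r / 2 .. u + r / 2}"
      by (subst nn_integral_cmult_indicator) (auto simp: p J_def)
    also have "\<dots> = ennreal (r powr (1 + s))"
      using p by (simp add: powr_add flip: ennreal_mult)
    finally show "(\<lambda>((x, u), r). ennreal (r powr (1 + s))) p =
        (\<integral>\<^sup>+t. ennreal (snd p powr s) * indicator (J p) t \<partial>lborel)"
      by (simp add: p)
  qed
  also have "\<dots> = (\<integral>\<^sup>+t. (\<Sum>p\<in>F. ennreal (snd p powr s) * indicator (J p) t) \<partial>lborel)"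
    by (rule nn_integral_sum[symmetric]) measurable
  also have "\<dots> \<le> (\<integral>\<^sup>+t. packing_pre s (\<delta> / 2) A * indicator {-M - 1..M + 1} t \<partial>lborel)"
    by (intro nn_integral_mono slice)
  also have "\<dots> = packing_pre s (\<delta> / 2) A * ennreal (2 * M + 2)"
    using M by (subst nn_integral_cmult_indicator) auto
  finally have le: "(\<Sum>((x, u), r)\<in>F. ennreal (r powr (1 + s))) \<le> packing_pre s (\<delta> / 2) A * ennreal (2 * M + 2)" .
  have "(\<Sum>(x, r)\<in>F. ennreal ((2 * r) powr (1 + s))) =
      (\<Sum>((x, u), r)\<in>F. ennreal (2 powr (1 + s)) * ennreal (r powr (1 + s)))"
    using sub by (intro sum.cong) (auto simp: powr_mult simp flip: ennreal_mult)
  also have "\<dots> = ennreal (2 powr (1 + s)) * (\<Sum>((x, u), r)\<in>F. ennreal (r powr (1 + s)))"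
    by (simp add: sum_distrib_left case_prod_beta del: sum_ennreal)
  also have "\<dots> \<le> ennreal (2 powr (1 + s)) * (packing_pre s (\<delta> / 2) A * ennreal (2 * M + 2))"
    by (intro mult_left_mono le) simp
  also have "\<dots> = ennreal (2 powr (1 + s) * (2 * M + 2)) * packing_pre s (\<delta> / 2) A"
    using M by (simp add: ennreal_mult mult_ac)
  finally show "(\<Sum>(x, r)\<in>F. ennreal ((2 * r) powr (1 + s)))
    \<le> ennreal (2 powr (1 + s) * (2 * M + 2)) * packing_pre s (\<delta> / 2) A" .
qed

lemma packing_measure_times_interval_eq_0:
  fixes A :: "'a::metric_space set"
  assumes A: "packing_measure s A = 0" and M: "0 \<le> (M::real)"
  shows "packing_measure (1 + s) (A \<times> {-M..M}) = 0"
proof -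
  define C where "C = 2 powr (1 + s) * (2 * M + 2)"
  have "C > 0" using M by (simp add: C_def)
  have pre: "packing_premeasure (1 + s) (E \<times> {-M..M}) \<le> ennreal C * packing_premeasure s E" for E :: "'a set"
  proof -
    have "packing_premeasure (1 + s) (E \<times> {-M..M}) \<le> ennreal C * packing_pre s \<delta> E" if "0 < \<delta>" for \<delta>
    proof -
      define \<eta> where "\<eta> = min \<delta> 1"
      have \<eta>: "0 < \<eta>" "\<eta> \<le> 1" "\<eta> / 2 \<le> \<delta>" using that by (auto simp: \<eta>_def)
      have "packing_premeasure (1 + s) (E \<times> {-M..M}) \<le> packing_pre (1 + s) \<eta> (E \<times> {-M..M})"
        by (intro packing_premeasure_le_pre \<eta>)
      also have "\<dots> \<le> ennreal C * packing_pre s (\<eta> / 2) E"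
        unfolding C_def by (intro packing_pre_times_interval \<eta> M)
      also have "\<dots> \<le> ennreal C * packing_pre s \<delta> E"
        by (intro mult_left_mono packing_pre_mono \<eta>) auto
      finally show ?thesis .
    qed
    then show ?thesis
      unfolding packing_premeasure_def[of s] using \<open>C > 0\<close> by (intro le_cmult_INF_ennreal) auto
  qed
  have "packing_measure (1 + s) (A \<times> {-M..M}) \<le> ennreal C * (\<Sum>i. packing_premeasure s (E i))"
    if "A \<subseteq> (\<Union>i. E i)" for E :: "nat \<Rightarrow> 'a set"
  proof -
    have "packing_measure (1 + s) (A \<times> {-M..M}) \<le> (\<Sum>i. packing_premeasure (1 + s) (E i \<times> {-M..M}))"
      unfolding packing_measure_def by (rule INF_lower) (use that in auto)
    also have "\<dots> \<le> (\<Sum>i. ennreal C * packing_premeasure s (E i))"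
      by (intro suminf_le pre) auto
    finally show ?thesis by simp
  qed
  then have "packing_measure (1 + s) (A \<times> {-M..M}) \<le> ennreal C * packing_measure s A"
    unfolding packing_measure_def[of s] using \<open>C > 0\<close> by (intro le_cmult_INF_ennreal) auto
  then show ?thesis using A by simp
qed

subsection \<open>Hausdorff dimension is at most packing dimension\<close>

text \<open>If no further disjoint ball of radius \<rho> can be added to a packing, the balls of
  radius \<open>2 * \<rho>\<close> about its centres cover \<open>E\<close>. They have diameter at
  most \<open>4 * \<rho>\<close>, twice the length \<open>2 * \<rho>\<close> used as packing weight;
  hence the factor \<open>2 powr s\<close>.\<close>

lemma hausdorff_pre_le_packing_pre:
  fixes E :: "'a::metric_space set"
  assumes "0 < \<rho>" "0 < s"
  shows "hausdorff_pre s (4 * \<rho>) E \<le> ennreal (2 powr s) * packing_pre s \<rho> E"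
proof (cases "packing_pre s \<rho> E = top")
  case True
  then show ?thesis by (simp add: ennreal_mult_top)
next
  case False
  define P where "P S \<longleftrightarrow> finite S \<and> S \<subseteq> E \<and> disjoint_family_on (\<lambda>x. cball x \<rho>) S" for S :: "'a set"
  obtain c where c: "packing_pre s \<rho> E = ennreal c" "0 \<le> c"
    using False by (cases "packing_pre s \<rho> E") auto
  have le: "real (card S) * (2 * \<rho>) powr s \<le> c" if "P S" for S
  proof -
    have "S \<times> {\<rho>} \<in> packings \<rho> E"
      using that assms by (auto simp: packings_def P_def disjoint_family_on_def countable_finite)
    then have "(\<Sum>(x, r)\<in>S \<times> {\<rho>}. ennreal ((2 * r) powr s)) \<le> packing_pre s \<rho> E"
      using that by (intro packing_pre_ge) (auto simp: P_def)
    also have "(\<Sum>(x, r)\<in>S \<times> {\<rho>}. ennreal ((2 * r) powr s)) = ennreal (real (card S) * (2 * \<rho>) powr s)"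
    proof -
      have "(\<Sum>(x, r)\<in>S \<times> {\<rho>}. ennreal ((2 * r) powr s)) = (\<Sum>x\<in>S. ennreal ((2 * \<rho>) powr s))"
        by (subst sum.cartesian_product[symmetric]) simp
      then show ?thesis by (simp add: ennreal_mult' ennreal_of_nat_eq_real_of_nat)
    qed
    finally show ?thesis using c by (simp add: ennreal_le_iff)
  qed
  \<comment> \<open>The finite value \<open>c\<close> bounds the number of balls, so a packing of
    greatest cardinality exists.\<close>
  have "card S \<le> nat \<lfloor>c / (2 * \<rho>) powr s\<rfloor>" if "P S" for S
    using le[OF that] assms by (simp add: le_nat_floor pos_le_divide_eq)
  moreover have "P {}" by (simp add: P_def disjoint_family_on_def)
  ultimately obtain S where S: "P S" "\<And>T. P T \<Longrightarrow> card T \<le> card S"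
    using ex_has_greatest_nat[of P "{}" card] by (metis le_imp_less_Suc)
  obtain h where h: "bij_betw h {..<card S} S"
    using S(1) ex_bij_betw_nat_finite[of S] by (auto simp: P_def atLeast0LessThan)
  have "hausdorff_pre s (4 * \<rho>) E \<le> ennreal (real (card S) * (4 * \<rho>) powr s)"
  proof (rule hausdorff_pre_finite_cover)
    show "E \<subseteq> (\<Union>j<card S. cball (h j) (2 * \<rho>))"
    proof
      fix x
      assume "x \<in> E"
      have "\<exists>y\<in>S. dist y x \<le> 2 * \<rho>"
      proof (rule ccontr)
        assume "\<not> ?thesis"
        then have far: "2 * \<rho> < dist y x" if "y \<in> S" for y using that by force
        then have "x \<notin> S" using assms by force
        have "cball y \<rho> \<inter> cball x \<rho> = {}" if "y \<in> S" for y
        proof (rule ccontr)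
          assume "\<not> ?thesis"
          then obtain z where "dist y z \<le> \<rho>" "dist x z \<le> \<rho>" by auto
          then have "dist y x \<le> 2 * \<rho>" using dist_triangle2[of y x z] by simp
          with far[OF that] show False by simp
        qed
        then have "P (insert x S)"
          using S(1) \<open>x \<in> E\<close> \<open>x \<notin> S\<close> unfolding P_def
          by (auto simp: disjoint_family_on_insert)
        then show False
          using S(2)[of "insert x S"] \<open>x \<notin> S\<close> S(1) by (simp add: P_def)
      qed
      then obtain y where "y \<in> S" "dist y x \<le> 2 * \<rho>" by blast
      moreover have "y \<in> h ` {..<card S}"
        using \<open>y \<in> S\<close> h by (simp add: bij_betw_imp_surj_on)
      ultimately obtain j where "j < card S" "dist (h j) x \<le> 2 * \<rho>"
        by auto
      then show "x \<in> (\<Union>j<card S. cball (h j) (2 * \<rho>))" by auto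
    qed
    fix j x y
    assume "x \<in> cball (h j) (2 * \<rho>)" "y \<in> cball (h j) (2 * \<rho>)"
    then show "dist x y \<le> 4 * \<rho>" using dist_triangle3[of x y "h j"] by simp
  qed (use assms in auto)
  also have "real (card S) * (4 * \<rho>) powr s = 2 powr s * (real (card S) * (2 * \<rho>) powr s)"
    using assms by (simp add: powr_mult[of 2 "2 * \<rho>", symmetric])
  also have "ennreal \<dots> \<le> ennreal (2 powr s) * packing_pre s \<rho> E"
    unfolding c using le[OF S(1)] by (simp add: c(2) flip: ennreal_mult)
  finally show ?thesis .
qed

lemma hausdorff_pre_le_packing_premeasure:
  assumes "0 < \<delta>" "0 < s"
  shows "hausdorff_pre s \<delta> E \<le> ennreal (2 powr s) * packing_premeasure s E"
proof -
  have "hausdorff_pre s \<delta> E \<le> ennreal (2 powr s) * packing_pre s \<rho> E" if "0 < \<rho>" for \<rho>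
  proof -
    define \<eta> where "\<eta> = min \<rho> (\<delta> / 4)"
    have \<eta>: "0 < \<eta>" "\<eta> \<le> \<rho>" "4 * \<eta> \<le> \<delta>" using that assms by (auto simp: \<eta>_def)
    have "hausdorff_pre s \<delta> E \<le> hausdorff_pre s (4 * \<eta>) E"
      by (intro hausdorff_pre_mono \<eta>) simp
    also have "\<dots> \<le> ennreal (2 powr s) * packing_pre s \<eta> E"
      by (intro hausdorff_pre_le_packing_pre \<eta> assms)
    also have "\<dots> \<le> ennreal (2 powr s) * packing_pre s \<rho> E"
      by (intro mult_left_mono packing_pre_mono \<eta>) auto
    finally show ?thesis .
  qed
  then show ?thesis
    unfolding packing_premeasure_def by (intro le_cmult_INF_ennreal) auto
qed

lemma hausdorff_measure_le_packing_measure: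
  assumes "0 < s"
  shows "hausdorff_measure s A \<le> ennreal (2 powr s) * packing_measure s A"
  unfolding hausdorff_measure_def
proof (rule SUP_least)
  fix \<delta> :: real
  assume "\<delta> \<in> {0<..}"
  then have "0 < \<delta>" by simp
  have "hausdorff_pre s \<delta> A \<le> ennreal (2 powr s) * (\<Sum>i. packing_premeasure s (E i))"
    if "A \<subseteq> (\<Union>i. E i)" for E :: "nat \<Rightarrow> 'a set"
  proof -
    have "hausdorff_pre s \<delta> A \<le> (\<Sum>i. hausdorff_pre s \<delta> (E i))"
      using hausdorff_pre_mono[OF that order_refl] hausdorff_pre_subadditive by (rule order_trans)
    also have "\<dots> \<le> (\<Sum>i. ennreal (2 powr s) * packing_premeasure s (E i))"
      by (intro suminf_le hausdorff_pre_le_packing_premeasure \<open>0 < \<delta>\<close> assms) auto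
    finally show ?thesis by simp
  qed
  then show "hausdorff_pre s \<delta> A \<le> ennreal (2 powr s) * packing_measure s A"
    unfolding packing_measure_def by (intro le_cmult_INF_ennreal) auto
qed

lemma hausdorff_dim_le_packing_dim: "hausdorff_dim A \<le> packing_dim A"
  unfolding hausdorff_dim_def packing_dim_def
proof (intro Inf_superset_mono subsetI)
  fix d
  assume "d \<in> {ennreal s |s. 0 < s \<and> packing_measure s A = 0}"
  then obtain s where s: "d = ennreal s" "0 < s" "packing_measure s A = 0" by blast
  then have "hausdorff_measure s A = 0"
    using hausdorff_measure_le_packing_measure[of s A] by simp
  with s show "d \<in> {ennreal s |s. 0 < s \<and> hausdorff_measure s A = 0}" by blast
qed

subsection \<open>A Cantor scheme in an uncountable compact space\<close>

text \<open>Otherwise every point has a ball meeting \<open>S\<close> in a countable set, and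
  finitely many of these balls cover \<open>S\<close>.\<close>

lemma compact_uncountable_condensation_point:
  fixes S :: "'a::metric_space set"
  assumes "compact S" "uncountable S"
  obtains p where "p \<in> S" "\<And>r. 0 < r \<Longrightarrow> uncountable (S \<inter> cball p r)"
proof -
  have "\<exists>p\<in>S. \<forall>r>0. uncountable (S \<inter> cball p r)"
  proof (rule ccontr)
    assume "\<not> ?thesis"
    then obtain r where r: "\<And>p. p \<in> S \<Longrightarrow> 0 < r p \<and> countable (S \<inter> cball p (r p))"
      by metis
    obtain C where C: "C \<subseteq> S" "finite C" "S \<subseteq> (\<Union>p\<in>C. ball p (r p))"
      by (rule compactE_image[OF assms(1), of S "\<lambda>p. ball p (r p)"]) (use r in auto)
    have "S \<subseteq> (\<Union>p\<in>C. S \<inter> cball p (r p))"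
    proof
      fix x
      assume "x \<in> S"
      then obtain p where "p \<in> C" "x \<in> ball p (r p)" using C(3) by blast
      then show "x \<in> (\<Union>p\<in>C. S \<inter> cball p (r p))"
        using \<open>x \<in> S\<close> ball_subset_cball by blast
    qed
    moreover have "countable (\<Union>p\<in>C. S \<inter> cball p (r p))"
      using C(1) r by (intro countable_UN countable_finite[OF C(2)]) blast
    ultimately show False using assms(2) countable_subset by blast
  qed
  then show ?thesis using that by blast
qed

text \<open>Outside a small enough ball around one condensation point there still lie uncountably
  many points of \<open>S\<close>, and these have a condensation point of their own. Small balls
  around the two points give the halves.\<close>

lemma compact_uncountable_split:
  fixes S :: "'a::metric_space set"
  assumes S: "compact S" "uncountable S" and e: "0 < e"
  shows "\<exists>T :: bool \<Rightarrow> 'a set. (\<forall>b. compact (T b) \<and> uncountable (T b) \<and> T b \<subseteq> S \<and>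
    (\<forall>x\<in>T b. \<forall>y\<in>T b. dist x y \<le> e)) \<and> T True \<inter> T False = {}"
proof -
  obtain p where p: "p \<in> S" "\<And>r. 0 < r \<Longrightarrow> uncountable (S \<inter> cball p r)"
    using compact_uncountable_condensation_point[OF S] by blast
  have sub: "S \<subseteq> insert p (\<Union>n. S - ball p (1 / Suc n))"
  proof
    fix x
    assume "x \<in> S"
    show "x \<in> insert p (\<Union>n. S - ball p (1 / Suc n))"
    proof (cases "x = p")
      case False
      then have "0 < dist p x" by simp
      then obtain n where "1 / Suc n < dist p x"
        by (rule nat_approx_posE)
      then have "x \<in> S - ball p (1 / Suc n)" using \<open>x \<in> S\<close> by simp
      then show ?thesis by blast
    qed simp
  qed
  have "\<exists>n. uncountable (S - ball p (1 / Suc n))"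
  proof (rule ccontr)
    assume "\<not> ?thesis"
    then have "countable (\<Union>n. S - ball p (1 / Suc n))" by (intro countable_UN) auto
    then have "countable (insert p (\<Union>n. S - ball p (1 / Suc n)))" by (rule countable_insert)
    then show False using countable_subset[OF sub] S(2) by blast
  qed
  then obtain n where n: "uncountable (S - ball p (1 / Suc n))" by blast
  obtain q where q: "q \<in> S - ball p (1 / Suc n)"
    "\<And>r. 0 < r \<Longrightarrow> uncountable ((S - ball p (1 / Suc n)) \<inter> cball q r)"
    by (rule compact_uncountable_condensation_point[OF compact_diff[OF S(1) open_ball] n]) blast
  have q': "uncountable (S \<inter> cball q r)" if "0 < r" for r
    using q(2)[OF that] countable_subset[of "(S - ball p (1 / Suc n)) \<inter> cball q r" "S \<inter> cball q r"]
    by blast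
  have pq: "0 < dist p q" using q(1) by auto
  \<comment> \<open>\<open>e / 2\<close> controls the diameter of the halves; a third of the
    distance keeps them disjoint.\<close>
  define r where "r = min (e / 2) (dist p q / 3)"
  have "0 < r" "r \<le> e / 2" "r \<le> dist p q / 3" using pq e by (auto simp: r_def)
  then have r: "0 < r" "2 * r \<le> e" "2 * r < dist p q" using pq by linarith+
  have dist: "dist x y \<le> e" if "x \<in> cball z r" "y \<in> cball z r" for x y z
    using that dist_triangle3[of x y z] r by auto
  have "S \<inter> cball p r \<inter> (S \<inter> cball q r) = {}"
  proof (rule ccontr)
    assume "\<not> ?thesis"
    then obtain z where "dist p z \<le> r" "dist q z \<le> r" by auto
    then show False using dist_triangle2[of p q z] r by simp
  qed
  moreover have "compact (S \<inter> cball z r)" for z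
    using S(1) closed_cball by (rule compact_Int_closed)
  ultimately show ?thesis
    using p(2)[OF r(1)] q'[OF r(1)] dist
    by (intro exI[of _ "\<lambda>b. if b then S \<inter> cball p r else S \<inter> cball q r"]) auto
qed

text \<open>
  The index \<open>k\<close> of a set of generation \<open>n\<close> encodes \<open>n\<close> binary digits, so that \<open>k div 2\<close> is its
  parent. Only \<open>0 \<le> k < 2 ^ n\<close> matters; allowing all integers avoids side conditions.
\<close>

lemma compact_uncountable_cantor_scheme:
  fixes S :: "'a::metric_space set"
  assumes S: "compact S" "uncountable S"
  obtains K :: "nat \<Rightarrow> int \<Rightarrow> 'a set" where
    "\<And>n k. compact (K n k)" "\<And>n k. K n k \<noteq> {}" "\<And>n k. K (Suc n) k \<subseteq> K n (k div 2)"
    "\<And>n k x y. x \<in> K (Suc n) k \<Longrightarrow> y \<in> K (Suc n) k \<Longrightarrow> dist x y \<le> (1/2)^n"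
    "\<And>n k l. k \<in> {0..<2^n} \<Longrightarrow> l \<in> {0..<2^n} \<Longrightarrow> k \<noteq> l \<Longrightarrow> K n k \<inter> K n l = {}"
proof -
  \<comment> \<open>With compactness and uncountability as premises below the quantifier,
    \<open>T\<close> is defined on all sets and the recursion for \<open>K\<close> needs no
    invariant.\<close>
  have "\<exists>T :: bool \<Rightarrow> 'a set. compact S \<longrightarrow> uncountable S \<longrightarrow> (\<forall>b. compact (T b) \<and> uncountable (T b) \<and> T b \<subseteq> S \<and>
    (\<forall>x\<in>T b. \<forall>y\<in>T b. dist x y \<le> (1/2)^n)) \<and> T True \<inter> T False = {}" for S :: "'a set" and n
    using compact_uncountable_split[of S "(1/2)^n"] by auto
  then obtain T :: "'a set \<Rightarrow> nat \<Rightarrow> bool \<Rightarrow> 'a set" where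
    T: "\<And>S n. compact S \<longrightarrow> uncountable S \<longrightarrow> (\<forall>b. compact (T S n b) \<and> uncountable (T S n b) \<and> T S n b \<subseteq> S \<and>
    (\<forall>x\<in>T S n b. \<forall>y\<in>T S n b. dist x y \<le> (1/2)^n)) \<and> T S n True \<inter> T S n False = {}"
    by metis
  define K :: "nat \<Rightarrow> int \<Rightarrow> 'a set"
    where "K = rec_nat (\<lambda>k. S) (\<lambda>n Kn k. T (Kn (k div 2)) n (odd k))"
  have K_Suc: "K (Suc n) k = T (K n (k div 2)) n (odd k)" for n k by (simp add: K_def)
  have cu: "compact (K n k) \<and> uncountable (K n k)" for n k
  proof (induction n arbitrary: k)
    case 0
    then show ?case using S by (simp add: K_def)
  next
    case (Suc n)
    then show ?case unfolding K_Suc using T by blast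
  qed
  note T' = T[rule_format, OF conjunct1[OF cu] conjunct2[OF cu]]
  show ?thesis
  proof (rule that[of K])
    show "compact (K n k)" for n k using cu by blast
    show "K n k \<noteq> {}" for n k using cu[of n k] countable_empty by metis
    show "K (Suc n) k \<subseteq> K n (k div 2)" for n k unfolding K_Suc using T' by blast
    show "dist x y \<le> (1/2)^n" if "x \<in> K (Suc n) k" "y \<in> K (Suc n) k" for n k x y
      using that unfolding K_Suc using T' by blast
    show "K n k \<inter> K n l = {}" if "k \<in> {0..<2^n}" "l \<in> {0..<2^n}" "k \<noteq> l" for n k l
      using that
    proof (induction n arbitrary: k l)
      case (Suc n)
      show ?case
      proof (cases "k div 2 = l div 2")
        case True
        then have "odd k \<noteq> odd l" using Suc.prems(3) by presburger
        then have "T (K n (l div 2)) n (odd k) \<inter> T (K n (l div 2)) n (odd l) = {}"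
          using T' by (cases "odd k"; cases "odd l") (auto simp: Int_commute)
        then show ?thesis unfolding K_Suc True .
      next
        case False
        have "K n (k div 2) \<inter> K n (l div 2) = {}"
          using Suc.prems by (intro Suc.IH False) auto
        moreover have "K (Suc n) k \<subseteq> K n (k div 2)" "K (Suc n) l \<subseteq> K n (l div 2)"
          unfolding K_Suc using T' by blast+
        ultimately show ?thesis by blast
      qed
    qed auto
  qed
qed

section \<open>Binary digits, and a continuous function with a Borel right inverse\<close>

lemma floor_power_Suc_div: "\<lfloor>2 ^ Suc n * (u::real)\<rfloor> div 2 = \<lfloor>2 ^ n * u\<rfloor>"
proof -
  have "\<lfloor>2 ^ Suc n * u / real_of_int 2\<rfloor> = \<lfloor>2 ^ Suc n * u\<rfloor> div 2"
    by (rule floor_divide_real_eq_div) simp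
  moreover have "2 ^ Suc n * u / real_of_int 2 = 2 ^ n * u" by simp
  ultimately show ?thesis by (simp only:)
qed

text \<open>As the integer part of \<open>u\<close> is 0, the partial sums are the dyadic
  truncations \<open>\<lfloor>2 ^ n * u\<rfloor> * (1/2) ^ n\<close>.\<close>

lemma binary_expansion_sums:
  assumes "u \<in> {0..<1::real}"
  shows "(\<lambda>n. of_bool (odd \<lfloor>2 ^ Suc n * u\<rfloor>) * (1/2) ^ Suc n) sums u"
proof -
  have partial: "(\<Sum>i<n. of_bool (odd \<lfloor>2 ^ Suc i * u\<rfloor>) * (1/2::real) ^ Suc i) = of_int \<lfloor>2 ^ n * u\<rfloor> * (1/2) ^ n" for n
  proof (induction n)
    case 0
    have "\<lfloor>u\<rfloor> = 0" using assms by (simp add: floor_eq_iff)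
    then show ?case by simp
  next
    case (Suc n)
    define m where "m = \<lfloor>2 ^ Suc n * u\<rfloor>"
    have half: "m div 2 = \<lfloor>2 ^ n * u\<rfloor>" unfolding m_def by (rule floor_power_Suc_div)
    have "m = 2 * (m div 2) + of_bool (odd m)" by (cases "odd m") auto
    then have "real_of_int m = real_of_int (2 * (m div 2) + of_bool (odd m))" by (rule arg_cong)
    also have "\<dots> = 2 * real_of_int \<lfloor>2 ^ n * u\<rfloor> + of_bool (odd m)" by (simp add: half)
    finally have "real_of_int m = 2 * real_of_int \<lfloor>2 ^ n * u\<rfloor> + of_bool (odd m)" .
    moreover have "real_of_int \<lfloor>2 ^ n * u\<rfloor> * (1/2) ^ n + of_bool (odd m) * (1/2) ^ Suc n
        = (2 * real_of_int \<lfloor>2 ^ n * u\<rfloor> + of_bool (odd m)) * (1/2) ^ Suc n"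
      by (simp add: algebra_simps)
    ultimately show ?case
      unfolding sum.lessThan_Suc Suc.IH m_def by (simp only:)
  qed
  have "(\<lambda>n. of_int \<lfloor>2 ^ n * u\<rfloor> * (1/2) ^ n) \<longlonglongrightarrow> u"
  proof (rule LIMSEQ_I)
    fix r :: real
    assume "0 < r"
    then obtain N where N: "(1/2) ^ N < r" using real_arch_pow_inv[of r "1/2"] by auto
    show "\<exists>N. \<forall>n\<ge>N. norm (of_int \<lfloor>2 ^ n * u\<rfloor> * (1/2) ^ n - u) < r"
    proof (intro exI allI impI)
      fix n
      assume "N \<le> n"
      then have "(1/2::real) ^ n \<le> (1/2) ^ N" by (intro power_decreasing) auto
      have "of_int \<lfloor>2 ^ n * u\<rfloor> * (1/2) ^ n - u = (of_int \<lfloor>2 ^ n * u\<rfloor> - 2 ^ n * u) * (1/2) ^ n"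
        by (simp add: left_diff_distrib diff_divide_distrib power_one_over)
      then have "norm (of_int \<lfloor>2 ^ n * u\<rfloor> * (1/2) ^ n - u) = \<bar>of_int \<lfloor>2 ^ n * u\<rfloor> - 2 ^ n * u\<bar> * (1/2) ^ n"
        by (simp only: real_norm_def abs_mult) simp
      also have "\<dots> \<le> 1 * (1/2) ^ n"
      proof (rule mult_right_mono)
        show "\<bar>of_int \<lfloor>2 ^ n * u\<rfloor> - 2 ^ n * u\<bar> \<le> 1" by linarith
      qed simp
      finally show "norm (of_int \<lfloor>2 ^ n * u\<rfloor> * (1/2) ^ n - u) < r"
        using N \<open>(1/2::real) ^ n \<le> (1/2) ^ N\<close> by linarith
    qed
  qed
  then show ?thesis unfolding sums_def partial .
qed

text \<open>The indices \<open>\<lfloor>2 ^ n * u\<rfloor>\<close> follow one branch of the Cantor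
  scheme, and \<open>g u\<close> is a point on that branch. In the other direction \<Phi> reads off
  the digits: each digit is a continuous function on the whole space, and the digits are summed with
  weights \<open>(1/2) ^ Suc n\<close>.\<close>

lemma continuous_function_with_borel_section:
  assumes compact: "compact (UNIV :: 'a::metric_space set)" and uncountable: "uncountable (UNIV :: 'a set)"
  obtains \<Phi> :: "'a::metric_space \<Rightarrow>\<^sub>C real" and g :: "real \<Rightarrow> 'a"
  where "g \<in> borel_measurable borel" "\<forall>u\<in>{0..<1}. apply_bcontfun \<Phi> (g u) = u"
proof -
  obtain K :: "nat \<Rightarrow> int \<Rightarrow> 'a set" where
    K: "\<And>n k. compact (K n k)" "\<And>n k. K n k \<noteq> {}" "\<And>n k. K (Suc n) k \<subseteq> K n (k div 2)"
    "\<And>n k x y. x \<in> K (Suc n) k \<Longrightarrow> y \<in> K (Suc n) k \<Longrightarrow> dist x y \<le> (1/2)^n"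
    "\<And>n k l. k \<in> {0..<2^n} \<Longrightarrow> l \<in> {0..<2^n} \<Longrightarrow> k \<noteq> l \<Longrightarrow> K n k \<inter> K n l = {}"
    using compact_uncountable_cantor_scheme[OF compact uncountable] by metis

  define c where "c n k = (SOME x. x \<in> K n k)" for n k
  have c: "c n k \<in> K n k" for n k unfolding c_def using K(2) by (simp add: some_in_eq)
  have nested: "K n \<lfloor>2 ^ n * u\<rfloor> \<subseteq> K m \<lfloor>2 ^ m * u\<rfloor>" if "m \<le> n" for m n and u :: real
    using that
  proof (induction n rule: dec_induct)
    case (step n)
    have "K (Suc n) \<lfloor>2 ^ Suc n * u\<rfloor> \<subseteq> K n \<lfloor>2 ^ n * u\<rfloor>"
      using K(3)[of n "\<lfloor>2 ^ Suc n * u\<rfloor>"] unfolding floor_power_Suc_div .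
    with step.IH show ?case by blast
  qed simp
  have "\<exists>x. \<forall>n. x \<in> K n \<lfloor>2 ^ n * u\<rfloor>" for u :: real
  proof -
    obtain l r where lr: "strict_mono r" "((\<lambda>n. c n \<lfloor>2 ^ n * u\<rfloor>) \<circ> r) \<longlonglongrightarrow> l"
      using compact[unfolded compact_def, rule_format, of "\<lambda>n. c n \<lfloor>2 ^ n * u\<rfloor>"] by auto
    \<comment> \<open>Shifting the subsequence by \<open>n\<close> puts all its terms at generation
      \<open>n\<close> or later, since \<open>r (m + n) \<ge> m + n\<close>.\<close>
    have "l \<in> K n \<lfloor>2 ^ n * u\<rfloor>" for n
    proof (rule closed_sequentially[of _ "\<lambda>m. c (r (m + n)) \<lfloor>2 ^ r (m + n) * u\<rfloor>"])
      show "closed (K n \<lfloor>2 ^ n * u\<rfloor>)" using K(1) by (rule compact_imp_closed)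
      show "c (r (m + n)) \<lfloor>2 ^ r (m + n) * u\<rfloor> \<in> K n \<lfloor>2 ^ n * u\<rfloor>" for m
        using c nested[of n "r (m + n)" u] seq_suble[OF lr(1), of "m + n"] by auto
      show "(\<lambda>m. c (r (m + n)) \<lfloor>2 ^ r (m + n) * u\<rfloor>) \<longlonglongrightarrow> l"
        using LIMSEQ_ignore_initial_segment[OF lr(2), of n] by (simp add: o_def)
    qed
    then show ?thesis by blast
  qed
  then obtain g :: "real \<Rightarrow> 'a" where g: "\<And>u n. g u \<in> K n \<lfloor>2 ^ n * u\<rfloor>" by metis
  have g_lim: "(\<lambda>n. c n \<lfloor>2 ^ n * u\<rfloor>) \<longlonglongrightarrow> g u" for u :: real
  \<comment> \<open>The diameters are controlled only from generation 1 on, hence the shift.\<close>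
  proof (subst filterlim_sequentially_Suc[symmetric], rule metric_LIMSEQ_I)
    fix r :: real
    assume "0 < r"
    then obtain N where N: "(1/2) ^ N < r" using real_arch_pow_inv[of r "1/2"] by auto
    show "\<exists>N. \<forall>n\<ge>N. dist (c (Suc n) \<lfloor>2 ^ Suc n * u\<rfloor>) (g u) < r"
    proof (intro exI allI impI)
      fix n
      assume "N \<le> n"
      then have "(1/2::real) ^ n \<le> (1/2) ^ N" by (intro power_decreasing) auto
      with K(4)[OF c g[of u "Suc n"]] N
      show "dist (c (Suc n) \<lfloor>2 ^ Suc n * u\<rfloor>) (g u) < r" by linarith
    qed
  qed
  have g_borel: "g \<in> borel_measurable borel"
  proof (rule borel_measurable_LIMSEQ_metric)
    show "(\<lambda>u::real. c n \<lfloor>2 ^ n * u\<rfloor>) \<in> borel_measurable borel" for n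
      by (rule measurable_compose[of "\<lambda>u::real. \<lfloor>2 ^ n * u\<rfloor>" borel "count_space UNIV"]) auto
  qed (rule g_lim)

  \<comment> \<open>The sets of generation \<open>n + 1\<close> whose last digit is
    \<open>b\<close>. Restricting \<open>k\<close> to the genuine indices makes the union finite,
    hence closed, and \<open>D True n\<close> disjoint from \<open>D False n\<close>.\<close>
  define D where "D b n = (\<Union>k\<in>{k \<in> {0..<2 ^ Suc n}. odd k = b}. K (Suc n) k)" for b n
  have D_closed: "closed (D b n)" for b n
    unfolding D_def
  proof (rule closed_UN)
    show "finite {k \<in> {0..<2 ^ Suc n}. odd (k::int) = b}"
      by (rule finite_subset[of _ "{0..<2 ^ Suc n}"]) auto
  qed (use K(1) compact_imp_closed in blast)
  have D_disj: "D True n \<inter> D False n = {}" for n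
  proof (rule ccontr)
    assume "\<not> ?thesis"
    then obtain x k l where "x \<in> K (Suc n) k" "x \<in> K (Suc n) l" "odd k" "even l"
      "k \<in> {0..<2 ^ Suc n}" "l \<in> {0..<2 ^ Suc n}"
      unfolding D_def by blast
    then show False using K(5)[of k "Suc n" l] by blast
  qed
  \<comment> \<open>\<open>infdist\<close> to the empty set is 0, so the denominator of
    \<open>e\<close> is positive only because of this.\<close>
  have D_ne: "D b n \<noteq> {}" for b n
  proof -
    have "(1::int) < 2 ^ Suc n" by (rule one_less_power) auto
    then have "of_bool b \<in> {k \<in> {0..<2 ^ Suc n}. odd (k::int) = b}" by (cases b) simp_all
    then show ?thesis unfolding D_def using K(2) by blast
  qed
  \<comment> \<open>A Urysohn function: 1 on \<open>D True n\<close> and 0 on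
    \<open>D False n\<close>.\<close>
  define e where "e n x = infdist x (D False n) / (infdist x (D True n) + infdist x (D False n))" for n x
  have e_pos: "0 < infdist x (D True n) + infdist x (D False n)" for n x
  proof -
    have "infdist x (D b n) = 0 \<longleftrightarrow> x \<in> D b n" for b
      using in_closed_iff_infdist_zero[OF D_closed D_ne] by blast
    then have "infdist x (D True n) \<noteq> 0 \<or> infdist x (D False n) \<noteq> 0"
      using D_disj[of n] by blast
    then show ?thesis
      using infdist_nonneg[of x "D True n"] infdist_nonneg[of x "D False n"] by linarith
  qed
  have e_cont: "continuous_on UNIV (e n)" for n
    unfolding e_def using e_pos by (intro continuous_intros) (auto simp: less_imp_neq[symmetric])
  have e_bound: "0 \<le> e n x" "e n x \<le> 1" for n x
    using e_pos[of x n] infdist_nonneg[of x] by (auto simp: e_def divide_le_eq_1)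
  have e_g: "e n (g u) = of_bool (odd \<lfloor>2 ^ Suc n * u\<rfloor>)" if "u \<in> {0..<1}" for n u
  proof -
    have "2 ^ Suc n * u < 2 ^ Suc n" using that by auto
    then have "\<lfloor>2 ^ Suc n * u\<rfloor> \<in> {0..<2 ^ Suc n}"
      using that by (auto simp: floor_less_iff simp del: power_Suc)
    then have "g u \<in> D (odd \<lfloor>2 ^ Suc n * u\<rfloor>) n"
      unfolding D_def using g by blast
    then have "infdist (g u) (D (odd \<lfloor>2 ^ Suc n * u\<rfloor>) n) = 0" by simp
    then show ?thesis
      using e_pos[of "g u" n] by (cases "odd \<lfloor>2 ^ Suc n * u\<rfloor>") (auto simp: e_def)
  qed
  define \<phi> where "\<phi> x = (\<Sum>n. e n x * (1/2) ^ Suc n)" for x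
  have "uniform_limit UNIV (\<lambda>n x. \<Sum>i<n. e i x * (1/2) ^ Suc i) \<phi> sequentially"
    unfolding \<phi>_def
  proof (rule Weierstrass_m_test)
    show "norm (e n x * (1/2) ^ Suc n) \<le> (1/2) ^ Suc n" for n x
      using e_bound[of n x] by (simp add: abs_mult)
    show "summable (\<lambda>n. (1/2::real) ^ Suc n)" using power_half_series by (rule sums_summable)
  qed
  then have cont: "continuous_on UNIV \<phi>"
    by (rule uniform_limit_theorem[rotated])
      (auto intro!: always_eventually continuous_intros e_cont)
  then have "\<phi> \<in> bcontfun"
    using compact_imp_bounded[OF compact_continuous_image[OF cont compact]] by (simp add: bcontfun_def)
  moreover have "\<phi> (g u) = u" if "u \<in> {0..<1}" for u
    unfolding \<phi>_def e_g[OF that] using binary_expansion_sums[OF that] by (rule sums_unique[symmetric])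
  ultimately show ?thesis
    using g_borel by (intro that[of g "Bcontfun \<phi>"]) (simp_all add: Bcontfun_inverse)
qed

subsection \<open>Riesz energies\<close>

text \<open>The value at 0 is \<open>\<infinity>\<close>, which is why the inverse is taken in \<open>ennreal\<close>.\<close>

definition riesz_kernel :: "real \<Rightarrow> real \<Rightarrow> ennreal" where
  "riesz_kernel s x = inverse (ennreal (\<bar>x\<bar> powr s))"

definition riesz_energy :: "real \<Rightarrow> 'a measure \<Rightarrow> ('a \<Rightarrow> real) \<Rightarrow> ennreal" where
  "riesz_energy s \<mu> f = (\<integral>\<^sup>+p. riesz_kernel s (f (fst p) - f (snd p)) \<partial>(\<mu> \<Otimes>\<^sub>M \<mu>))"

lemma riesz_kernel_0 [simp]: "riesz_kernel s 0 = top"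
  by (simp add: riesz_kernel_def)

lemma riesz_kernel_nonzero: "x \<noteq> 0 \<Longrightarrow> riesz_kernel s x = ennreal (\<bar>x\<bar> powr (- s))"
  by (simp add: riesz_kernel_def inverse_ennreal powr_minus)

lemma riesz_kernel_minus [simp]: "riesz_kernel s (- x) = riesz_kernel s x"
  by (simp add: riesz_kernel_def)

lemma riesz_kernel_mult:
  "x \<noteq> 0 \<Longrightarrow> y \<noteq> 0 \<Longrightarrow> riesz_kernel s (x * y) = riesz_kernel s x * riesz_kernel s y"
  by (simp add: riesz_kernel_nonzero abs_mult powr_mult flip: ennreal_mult)

lemma riesz_kernel_antimono:
  assumes "0 < s" "\<bar>x\<bar> \<le> \<bar>y\<bar>"
  shows "riesz_kernel s y \<le> riesz_kernel s x"
proof (cases "x = 0")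
  case False
  then show ?thesis
    using assms by (auto simp: riesz_kernel_nonzero intro!: ennreal_leI powr_mono2')
qed simp

lemma continuous_on_riesz_kernel:
  assumes "0 < s"
  shows "continuous_on UNIV (riesz_kernel s)"
  unfolding riesz_kernel_def
  by (intro continuous_intros continuous_on_ennreal continuous_on_powr') (use assms in auto)

lemma borel_measurable_riesz_kernel [measurable]: "riesz_kernel s \<in> borel_measurable borel"
  unfolding riesz_kernel_def by measurable

text \<open>Within distance 1 of \<open>c\<close> the kernel integrates to
  \<open>2 / (1 - s)\<close>; elsewhere it is at most 1 and the interval has length
  \<open>2 * T\<close>.\<close>

lemma nn_integral_riesz_kernel_translate:
  assumes s: "0 < s" "s < 1" and T: "0 \<le> T"
  shows "(\<integral>\<^sup>+t. riesz_kernel s (t - c) * indicator {-T..T} t \<partial>lborel) \<le> ennreal (2 / (1 - s) + 2 * T)"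
proof -
  define g where "g x = ennreal (x powr (- s)) * indicator {0..1} x" for x :: real
  have [measurable]: "g \<in> borel_measurable borel" unfolding g_def by measurable
  have "((\<lambda>x. x powr (- s)) has_integral (1 powr (- s + 1) / (- s + 1))) {0..1}"
    by (rule has_integral_powr_from_0) (use s in auto)
  then have g: "(\<integral>\<^sup>+x. g x \<partial>lborel) = ennreal (1 / (1 - s))"
    unfolding g_def by (subst nn_integral_has_integral_lebesgue') (auto simp: add.commute)
  have g': "(\<integral>\<^sup>+x. g (- x) \<partial>lborel) = ennreal (1 / (1 - s))"
    using nn_integral_real_affine[of g "-1" 0] g by simp
  have "(\<integral>\<^sup>+t. riesz_kernel s (t - c) * indicator {-T..T} t \<partial>lborel)
      \<le> (\<integral>\<^sup>+t. (g (t - c) + g (- (t - c))) + indicator {-T..T} t \<partial>lborel)"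
  proof (rule nn_integral_mono_AE)
    \<comment> \<open>At \<open>t = c\<close> the kernel is infinite, but \<open>g 0 = 0\<close>
      because \<open>0 powr (- s) = 0\<close>.\<close>
    have "AE t in lborel. t \<noteq> c" by (rule AE_lborel_singleton)
    then show "AE t in lborel. riesz_kernel s (t - c) * indicator {-T..T} t
        \<le> (g (t - c) + g (- (t - c))) + indicator {-T..T} t"
    proof eventually_elim
      case (elim t)
      show ?case
      proof (cases "\<bar>t - c\<bar> \<le> 1")
        case True
        have "riesz_kernel s (t - c) * indicator {-T..T} t \<le> riesz_kernel s (t - c)"
          by (auto simp: indicator_def)
        also have "\<dots> \<le> g (t - c) + g (- (t - c))"
        proof (cases "t < c")
          case less: True
          then have "riesz_kernel s (t - c) = g (- (t - c))"
            using True by (simp add: g_def riesz_kernel_nonzero)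
          then show ?thesis by simp
        next
          case False
          then have "riesz_kernel s (t - c) = g (t - c)"
            using True elim by (simp add: g_def riesz_kernel_nonzero)
          then show ?thesis by simp
        qed
        finally show ?thesis by (rule add_increasing2[rotated]) simp
      next
        case False
        then have "riesz_kernel s (t - c) \<le> riesz_kernel s 1"
          by (intro riesz_kernel_antimono s) auto
        then have "riesz_kernel s (t - c) \<le> 1"
          by (simp add: riesz_kernel_nonzero)
        then show ?thesis by (intro add_increasing) (auto simp: indicator_def)
      qed
    qed
  qed
  also have "\<dots> = ((\<integral>\<^sup>+t. g (t - c) \<partial>lborel) + (\<integral>\<^sup>+t. g (- (t - c)) \<partial>lborel)) + emeasure lborel {-T..T}"
    by (simp add: nn_integral_add)
  also have "(\<integral>\<^sup>+t. g (t - c) \<partial>lborel) = ennreal (1 / (1 - s))"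
    using nn_integral_real_affine[of g 1 "- c"] g by simp
  also have "(\<integral>\<^sup>+t. g (- (t - c)) \<partial>lborel) = ennreal (1 / (1 - s))"
    using nn_integral_real_affine[of "\<lambda>x. g (- x)" 1 "- c"] g' by simp
  also have "ennreal (1 / (1 - s)) + ennreal (1 / (1 - s)) + emeasure lborel {-T..T} = ennreal (2 / (1 - s) + 2 * T)"
    using s T by (simp flip: ennreal_plus add: field_simps)
  finally show ?thesis .
qed

text \<open>Factoring out \<open>b\<close> leaves the translated kernel centred at
  \<open>- a / b\<close>, whose bound does not depend on the centre.\<close>

lemma nn_integral_riesz_kernel_affine:
  assumes s: "0 < s" "s < 1" and T: "0 \<le> T"
  shows "(\<integral>\<^sup>+t. riesz_kernel s (a + t * b) * indicator {-T..T} t \<partial>lborel)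
    \<le> ennreal (2 / (1 - s) + 2 * T) * riesz_kernel s b"
proof (cases "b = 0")
  case True
  \<comment> \<open>For \<open>b = 0\<close> the right-hand side is infinite, as the constant is not
    0.\<close>
  have "0 < 2 / (1 - s) + 2 * T" using s T by (intro add_pos_nonneg) auto
  with True show ?thesis by (simp add: ennreal_mult_top)
next
  case False
  have "(\<integral>\<^sup>+t. riesz_kernel s (a + t * b) * indicator {-T..T} t \<partial>lborel)
      = (\<integral>\<^sup>+t. riesz_kernel s b * (riesz_kernel s (t - (- a / b)) * indicator {-T..T} t) \<partial>lborel)"
  proof (rule nn_integral_cong_AE)
    have "AE t in lborel. t \<noteq> - a / b" by (rule AE_lborel_singleton)
    then show "AE t in lborel. riesz_kernel s (a + t * b) * indicator {-T..T} t
        = riesz_kernel s b * (riesz_kernel s (t - (- a / b)) * indicator {-T..T} t)"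
    proof eventually_elim
      case (elim t)
      have "a + t * b = b * (t - (- a / b))" using False by (simp add: field_simps)
      then have "riesz_kernel s (a + t * b) = riesz_kernel s b * riesz_kernel s (t - (- a / b))"
        using elim False by (simp only:) (rule riesz_kernel_mult, auto)
      then show ?case by (simp add: mult.assoc)
    qed
  qed
  also have "\<dots> = riesz_kernel s b * (\<integral>\<^sup>+t. riesz_kernel s (t - (- a / b)) * indicator {-T..T} t \<partial>lborel)"
    by (rule nn_integral_cmult) measurable
  also have "\<dots> \<le> riesz_kernel s b * ennreal (2 / (1 - s) + 2 * T)"
    by (intro mult_left_mono nn_integral_riesz_kernel_translate s T) simp
  finally show ?thesis by (simp add: mult.commute)
qed

lemma AE_finite_riesz_energy:
  assumes \<mu>: "sigma_finite_measure \<mu>" and [measurable]: "f \<in> borel_measurable \<mu>" "\<phi> \<in> borel_measurable \<mu>"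
    and s: "0 < s" "s < 1" and fin: "riesz_energy s \<mu> \<phi> < \<infinity>"
  shows "AE t in lborel. riesz_energy s \<mu> (\<lambda>x. f x + t * \<phi> x) < \<infinity>"
proof -
  interpret \<mu>: pair_sigma_finite \<mu> \<mu> using \<mu> by (intro pair_sigma_finite.intro)
  interpret pair_sigma_finite "\<mu> \<Otimes>\<^sub>M \<mu>" "lborel :: real measure" ..
  \<comment> \<open>As \<open>s < 1\<close>, the kernel decays too slowly to be integrable over the
    line. So \<open>t\<close> is confined to \<open>{-T..T}\<close>, and the windows
    \<open>T = n\<close> exhaust the line.\<close>
  define h where "h T p t = riesz_kernel s ((f (fst p) - f (snd p)) + t * (\<phi> (fst p) - \<phi> (snd p)))
    * indicator {-T..T} t" for T :: real and p t
  have h [measurable]: "case_prod (h T) \<in> borel_measurable ((\<mu> \<Otimes>\<^sub>M \<mu>) \<Otimes>\<^sub>M lborel)" for T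
    unfolding h_def by measurable
  have energy: "riesz_energy s \<mu> (\<lambda>x. f x + t * \<phi> x) * indicator {-T..T} t = (\<integral>\<^sup>+p. h T p t \<partial>(\<mu> \<Otimes>\<^sub>M \<mu>))" for T t
    unfolding riesz_energy_def h_def
    by (subst nn_integral_multc[symmetric]) (auto simp: algebra_simps)
  have "AE t in lborel. \<forall>n::nat. (\<integral>\<^sup>+p. h (real n) p t \<partial>(\<mu> \<Otimes>\<^sub>M \<mu>)) \<noteq> \<infinity>"
    unfolding AE_all_countable
  proof
    fix n
    show "AE t in lborel. (\<integral>\<^sup>+p. h (real n) p t \<partial>(\<mu> \<Otimes>\<^sub>M \<mu>)) \<noteq> \<infinity>"
    proof (rule nn_integral_noteq_infinite)
      show "(\<lambda>t. \<integral>\<^sup>+p. h (real n) p t \<partial>(\<mu> \<Otimes>\<^sub>M \<mu>)) \<in> borel_measurable lborel"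
        using h[of "real n"] by measurable
      define C where "C = ennreal (2 / (1 - s) + 2 * real n)"
      have "(\<integral>\<^sup>+t. \<integral>\<^sup>+p. h (real n) p t \<partial>(\<mu> \<Otimes>\<^sub>M \<mu>) \<partial>lborel)
          = (\<integral>\<^sup>+p. \<integral>\<^sup>+t. h (real n) p t \<partial>lborel \<partial>(\<mu> \<Otimes>\<^sub>M \<mu>))"
        by (rule Fubini') (rule h)
      also have "\<dots> \<le> (\<integral>\<^sup>+p. C * riesz_kernel s (\<phi> (fst p) - \<phi> (snd p)) \<partial>(\<mu> \<Otimes>\<^sub>M \<mu>))"
        unfolding h_def C_def by (intro nn_integral_mono nn_integral_riesz_kernel_affine s) simp
      also have "\<dots> = C * riesz_energy s \<mu> \<phi>"
        unfolding riesz_energy_def by (rule nn_integral_cmult) measurable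
      also have "\<dots> < \<infinity>"
        using fin by (simp add: C_def ennreal_mult_less_top)
      finally show "(\<integral>\<^sup>+t. \<integral>\<^sup>+p. h (real n) p t \<partial>(\<mu> \<Otimes>\<^sub>M \<mu>) \<partial>lborel) \<noteq> \<infinity>" by simp
    qed
  qed
  then show ?thesis
  proof eventually_elim
    case (elim t)
    obtain n where n: "\<bar>t\<bar> \<le> real n" using real_arch_simple by blast
    then have "indicator {- real n..real n} t = (1 :: ennreal)" by (auto simp: indicator_def)
    then have "riesz_energy s \<mu> (\<lambda>x. f x + t * \<phi> x) = (\<integral>\<^sup>+p. h (real n) p t \<partial>(\<mu> \<Otimes>\<^sub>M \<mu>))"
      using energy[of t "real n"] by simp
    with elim show ?case by (simp add: less_top)
  qed
qed

text \<open>The energy is lower semicontinuous by Fatou's lemma.\<close>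

lemma closed_riesz_energy_le:
  assumes sets: "sets \<mu> = sets borel" and s: "0 < s"
  shows "closed {f :: 'a::metric_space \<Rightarrow>\<^sub>C real. riesz_energy s \<mu> (apply_bcontfun f) \<le> c}"
  unfolding closed_sequential_limits
proof safe
  fix f :: "nat \<Rightarrow> 'a \<Rightarrow>\<^sub>C real" and l
  assume le: "\<forall>n. f n \<in> {f. riesz_energy s \<mu> (apply_bcontfun f) \<le> c}" and lim: "f \<longlonglongrightarrow> l"
  have meas [measurable]: "apply_bcontfun g \<in> borel_measurable \<mu>" for g :: "'a \<Rightarrow>\<^sub>C real"
    unfolding measurable_cong_sets[OF sets refl] by (rule borel_measurable_continuous_onI) simp
  have pointwise: "(\<lambda>n. apply_bcontfun (f n) x) \<longlonglongrightarrow> apply_bcontfun l x" for x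
    using tendsto_uniform_limitI[OF tendsto_bcontfun_uniform_limit[OF lim]] by simp
  have "riesz_energy s \<mu> (apply_bcontfun l)
      = (\<integral>\<^sup>+p. liminf (\<lambda>n. riesz_kernel s (f n (fst p) - f n (snd p))) \<partial>(\<mu> \<Otimes>\<^sub>M \<mu>))"
    unfolding riesz_energy_def
  proof (intro nn_integral_cong lim_imp_Liminf[symmetric])
    fix p
    have "isCont (riesz_kernel s) (l (fst p) - l (snd p))"
      using continuous_on_riesz_kernel[OF s] by (simp add: continuous_on_eq_continuous_at)
    then show "(\<lambda>n. riesz_kernel s (f n (fst p) - f n (snd p))) \<longlonglongrightarrow> riesz_kernel s (l (fst p) - l (snd p))"
      by (rule isCont_tendsto_compose) (intro tendsto_diff pointwise)
  qed simp
  also have "\<dots> \<le> liminf (\<lambda>n. riesz_energy s \<mu> (apply_bcontfun (f n)))"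
    unfolding riesz_energy_def by (rule nn_integral_liminf) measurable
  also have "\<dots> \<le> c"
    using le by (intro Liminf_le) auto
  finally show "riesz_energy s \<mu> (apply_bcontfun l) \<le> c" .
qed

lemma borel_finite_riesz_energy:
  assumes "sets \<mu> = sets borel" "0 < s"
  shows "{f :: 'a::metric_space \<Rightarrow>\<^sub>C real. riesz_energy s \<mu> (apply_bcontfun f) < \<infinity>} \<in> sets borel"
proof -
  have "{f :: 'a \<Rightarrow>\<^sub>C real. riesz_energy s \<mu> (apply_bcontfun f) < \<infinity>}
      = (\<Union>n::nat. {f. riesz_energy s \<mu> (apply_bcontfun f) \<le> of_nat n})"
    by (auto intro: order.strict_trans1[OF _ of_nat_less_top]
        dest!: ennreal_Ex_less_of_nat intro: less_imp_le)
  then show ?thesis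
    using closed_riesz_energy_le[OF assms] by (auto intro!: borel_closed)
qed

text \<open>
  A cover of the graph can be refined to a partition \<open>W i\<close> of the domain, on which \<open>f\<close> oscillates by
  at most the diameter \<open>d i\<close> of the covering set. The energy is then at least the sum of
  \<open>\<mu> (W i)\<^sup>2 / d i ^ s\<close>, which by AM-GM and \<open>\<Sum> \<mu> (W i) = 1\<close> bounds \<open>\<Sum> d i ^ s\<close> from below.
\<close>

lemma hausdorff_measure_graph_pos:
  fixes f :: "'a::metric_space \<Rightarrow>\<^sub>C real"
  assumes \<mu>: "prob_space \<mu>" and sets: "sets \<mu> = sets borel" and s: "0 < s"
    and fin: "riesz_energy s \<mu> (apply_bcontfun f) < \<infinity>"
  shows "hausdorff_measure s (graph_of f) \<noteq> 0"
proof
  assume "hausdorff_measure s (graph_of f) = 0"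
  interpret prob_space \<mu> by (rule \<mu>)
  have space: "space \<mu> = UNIV" using sets_eq_imp_space_eq[OF sets] by simp
  have meas [measurable]: "apply_bcontfun f \<in> borel_measurable \<mu>"
    unfolding measurable_cong_sets[OF sets refl] by (rule borel_measurable_continuous_onI) simp
  define k where "k p = riesz_kernel s (f (fst p) - f (snd p))" for p
  have k_meas [measurable]: "k \<in> borel_measurable (\<mu> \<Otimes>\<^sub>M \<mu>)" unfolding k_def by measurable
  obtain I where I: "riesz_energy s \<mu> (apply_bcontfun f) = ennreal I" "0 \<le> I"
    using fin by (cases "riesz_energy s \<mu> (apply_bcontfun f)") auto
  \<comment> \<open>Chosen so that \<open>I / c \<le> 1\<close> and \<open>1 / c\<close> makes sense
    even if \<open>I\<close> vanishes; a cover with \<open>\<Sum> d i powr s < 1 / c\<close> will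
    then contradict the total mass 1.\<close>
  define c where "c = max I 1"
  have c: "1 \<le> c" "I \<le> c" by (auto simp: c_def)
  have "hausdorff_pre s 1 (graph_of f) < ennreal (1 / c)"
    using \<open>hausdorff_measure s (graph_of f) = 0\<close> c unfolding hausdorff_measure_eq_0_iff by simp
  then obtain U where U: "graph_of f \<subseteq> (\<Union>i. U i)" "\<And>i. bounded (U i)"
      "(\<Sum>i. ennreal (diameter (U i) powr s)) < ennreal (1 / c)"
    by (rule hausdorff_pre_less) blast
  define d where "d i = diameter (U i)" for i
  have d: "0 \<le> d i" for i unfolding d_def using U(2) by (rule diameter_ge_0)
  \<comment> \<open>Closures make the preimages closed, hence measurable, without changing the
    diameters.\<close>
  define V where "V i = (\<lambda>x. (x, f x)) -` closure (U i)" for i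
  define W where "W = disjointed V"
  have V: "V i \<in> sets \<mu>" for i
    unfolding V_def sets by (intro borel_closed closed_vimage closed_closure continuous_intros) auto
  then have W [measurable]: "W i \<in> sets \<mu>" for i
    unfolding W_def using sets.range_disjointed_sets'[of V \<mu>] by auto
  have W_disj: "disjoint_family W" unfolding W_def by (rule disjoint_family_disjointed)
  have W_un: "(\<Union>i. W i) = UNIV"
  proof -
    have "x \<in> (\<Union>i. V i)" for x
    proof -
      have "(x, f x) \<in> graph_of f" by (auto simp: graph_of_def)
      then obtain i where "(x, f x) \<in> U i" using U(1) by blast
      then have "(x, f x) \<in> closure (U i)" using closure_subset by blast
      then show ?thesis unfolding V_def by blast
    qed
    then show ?thesis unfolding W_def UN_disjointed_eq by auto
  qed
  have osc: "\<bar>f x - f y\<bar> \<le> d i" if "x \<in> W i" "y \<in> W i" for x y i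
  proof -
    have "(x, f x) \<in> closure (U i)" "(y, f y) \<in> closure (U i)"
      using that disjointed_subset[of V i] by (auto simp: W_def V_def)
    then have "dist (x, f x) (y, f y) \<le> d i"
      using diameter_bounded_bound[OF bounded_closure[OF U(2)]] by (simp add: d_def diameter_closure U(2))
    moreover have "dist (f x) (f y) \<le> dist (x, f x) (y, f y)"
      using dist_snd_le[of "(x, f x)" "(y, f y)"] by simp
    ultimately show ?thesis by (simp add: dist_real_def)
  qed
  define J where "J i = (\<integral>\<^sup>+p. k p * indicator (W i \<times> W i) p \<partial>(\<mu> \<Otimes>\<^sub>M \<mu>))" for i
  have J: "riesz_kernel s (d i) * ennreal ((measure \<mu> (W i))\<^sup>2) \<le> J i" for i
  proof -
    have "riesz_kernel s (d i) * ennreal ((measure \<mu> (W i))\<^sup>2)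
        = riesz_kernel s (d i) * emeasure (\<mu> \<Otimes>\<^sub>M \<mu>) (W i \<times> W i)"
      unfolding emeasure_pair_measure_Times[OF W W] emeasure_eq_measure
      by (simp add: power2_eq_square ennreal_mult)
    also have "\<dots> = (\<integral>\<^sup>+p. riesz_kernel s (d i) * indicator (W i \<times> W i) p \<partial>(\<mu> \<Otimes>\<^sub>M \<mu>))"
      by (rule nn_integral_cmult_indicator[symmetric]) measurable
    also have "\<dots> \<le> J i"
      unfolding J_def k_def
    proof (rule nn_integral_mono)
      fix p
      show "riesz_kernel s (d i) * indicator (W i \<times> W i) p
          \<le> riesz_kernel s (f (fst p) - f (snd p)) * indicator (W i \<times> W i) p"
        using osc[of "fst p" i "snd p"] d[of i] s
        by (cases p) (auto simp: indicator_def intro!: riesz_kernel_antimono)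
    qed
    finally show ?thesis .
  qed
  have sum_J: "(\<Sum>i. J i) \<le> ennreal I"
  proof -
    have "(\<Sum>i. J i) = (\<integral>\<^sup>+p. (\<Sum>i. k p * indicator (W i \<times> W i) p) \<partial>(\<mu> \<Otimes>\<^sub>M \<mu>))"
      unfolding J_def by (rule nn_integral_suminf[symmetric]) measurable
    also have "\<dots> \<le> (\<integral>\<^sup>+p. k p \<partial>(\<mu> \<Otimes>\<^sub>M \<mu>))"
    proof (rule nn_integral_mono)
      fix p
      have "disjoint_family (\<lambda>i. W i \<times> W i)"
        using W_disj by (auto simp: disjoint_family_on_def)
      then have "(\<Sum>i. indicator (W i \<times> W i) p) = (indicator (\<Union>i. W i \<times> W i) p :: ennreal)"
        by (rule suminf_indicator)
      then show "(\<Sum>i. k p * indicator (W i \<times> W i) p) \<le> k p"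
        by (auto simp: indicator_def)
    qed
    also have "\<dots> = ennreal I" using I(1) by (simp add: riesz_energy_def k_def)
    finally show ?thesis .
  qed
  \<comment> \<open>The weights \<open>c\<close> and \<open>1 / c\<close> multiply to 1: with
    \<open>D = d i powr s\<close> and \<open>m\<close> the mass of \<open>W i\<close>, this is
    \<open>0 \<le> (c * D - m)\<^sup>2 / (c * D)\<close> combined with
    \<open>m\<^sup>2 / D \<le> J i\<close>.\<close>
  have amgm: "ennreal (2 * measure \<mu> (W i)) \<le> ennreal c * ennreal (d i powr s) + ennreal (1 / c) * J i" for i
  proof (cases "measure \<mu> (W i) = 0")
    case False
    show ?thesis
    proof (cases "d i = 0")
      \<comment> \<open>Here \<open>f\<close> is constant on a set of positive measure, so the
        infinite value of the kernel at 0 makes \<open>J i\<close> infinite.\<close>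
      case True
      have "0 < (measure \<mu> (W i))\<^sup>2" using False by simp
      then have "J i = top" using J[of i] True by (simp add: ennreal_top_mult top_unique)
      then show ?thesis using c by (simp add: ennreal_mult_top)
    next
      case False
      define D m where "D = d i powr s" and "m = measure \<mu> (W i)"
      have D: "0 < D" using False by (simp add: D_def)
      have "0 \<le> (c * D - m)\<^sup>2 / (c * D)" using D c by simp
      also have "\<dots> = c * D + 1 / c * (inverse D * m\<^sup>2) - 2 * m"
        using D c by (simp add: field_simps power2_eq_square)
      finally have "2 * m \<le> c * D + 1 / c * (inverse D * m\<^sup>2)" by simp
      then have "ennreal (2 * m) \<le> ennreal (c * D + 1 / c * (inverse D * m\<^sup>2))"
        by (rule ennreal_leI)
      also have "\<dots> = ennreal c * ennreal D + ennreal (1 / c) * (ennreal (inverse D) * ennreal (m\<^sup>2))"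
      proof -
        have nn: "0 \<le> c" "0 \<le> D" "0 \<le> c * D" "0 \<le> 1 / c" "0 \<le> inverse D" "0 \<le> m\<^sup>2"
          "0 \<le> inverse D * m\<^sup>2" "0 \<le> 1 / c * (inverse D * m\<^sup>2)"
          using D c by auto
        show ?thesis
          by (simp only: ennreal_plus[OF nn(3,8)] ennreal_mult[OF nn(1,2)] ennreal_mult[OF nn(4,7)]
              ennreal_mult[OF nn(5,6)])
      qed
      also have "\<dots> \<le> ennreal c * ennreal D + ennreal (1 / c) * J i"
        using J[of i] False d[of i]
        by (intro add_left_mono mult_left_mono) (auto simp: riesz_kernel_nonzero D_def m_def powr_minus)
      finally show ?thesis by (simp add: D_def m_def)
    qed
  qed simp
  \<comment> \<open>Summing \<open>amgm\<close> gives \<open>2 < 1 + 1\<close>: the cover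
    contributes less than \<open>c * (1 / c)\<close>, the energy at most
    \<open>I / c\<close>.\<close>
  have "ennreal 2 = 2 * emeasure \<mu> (\<Union>i. W i)"
    using emeasure_space_1 by (simp add: W_un space)
  also have "\<dots> = 2 * (\<Sum>i. emeasure \<mu> (W i))"
    using W W_disj by (subst suminf_emeasure) auto
  also have "\<dots> = (\<Sum>i. 2 * emeasure \<mu> (W i))"
    by (rule ennreal_suminf_cmult[symmetric])
  also have "\<dots> = (\<Sum>i. ennreal (2 * measure \<mu> (W i)))"
    by (simp add: emeasure_eq_measure ennreal_mult')
  also have "\<dots> \<le> (\<Sum>i. ennreal c * ennreal (d i powr s) + ennreal (1 / c) * J i)"
    by (intro suminf_le amgm) auto
  also have "\<dots> = (\<Sum>i. ennreal c * ennreal (d i powr s)) + (\<Sum>i. ennreal (1 / c) * J i)"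
    by (rule suminf_add[symmetric]) auto
  also have "\<dots> = ennreal c * (\<Sum>i. ennreal (d i powr s)) + ennreal (1 / c) * (\<Sum>i. J i)"
    unfolding ennreal_suminf_cmult ..
  also have "\<dots> \<le> ennreal c * (\<Sum>i. ennreal (d i powr s)) + 1"
  proof (rule add_left_mono)
    have "ennreal (1 / c) * (\<Sum>i. J i) \<le> ennreal (1 / c) * ennreal I"
      by (intro mult_left_mono sum_J) simp
    also have "\<dots> = ennreal (1 / c * I)"
      using c I(2) by (intro ennreal_mult[symmetric]) auto
    also have "\<dots> \<le> ennreal 1"
      using c by (intro ennreal_leI) (simp add: field_simps)
    finally show "ennreal (1 / c) * (\<Sum>i. J i) \<le> 1" by simp
  qed
  also have "\<dots> < 1 + 1"
  proof -
    have sum_d: "(\<Sum>i. ennreal (d i powr s)) < ennreal (1 / c)"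
      using U(3) unfolding d_def .
    define r where "r = enn2real (\<Sum>i. ennreal (d i powr s))"
    have r: "(\<Sum>i. ennreal (d i powr s)) = ennreal r" "0 \<le> r"
      unfolding r_def using ennreal_enn2real[OF order.strict_trans[OF sum_d ennreal_less_top]]
      by (simp_all only: enn2real_nonneg)
    have "r < 1 / c" using sum_d unfolding r(1) using r(2) by (simp add: ennreal_less_iff)
    then have "c * r < 1" using c by (simp add: field_simps)
    have "ennreal c * (\<Sum>i. ennreal (d i powr s)) = ennreal (c * r)"
      unfolding r(1) using c r(2) by (intro ennreal_mult[symmetric]) auto
    also have "\<dots> < ennreal 1"
      using \<open>c * r < 1\<close> by (intro ennreal_lessI) auto
    finally have "ennreal c * (\<Sum>i. ennreal (d i powr s)) < 1" by simp
    then have "1 + ennreal c * (\<Sum>i. ennreal (d i powr s)) < 1 + 1"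
      unfolding ennreal_add_left_cancel_less by simp
    then show ?thesis by (simp only: add.commute)
  qed
  finally show False by simp
qed

subsection \<open>Dimensions of graphs\<close>

lemma hausdorff_dim_eq_0D:
  assumes "hausdorff_dim A = 0" "0 < e"
  obtains s where "0 < s" "s < e" "hausdorff_measure s A = 0"
proof -
  have "hausdorff_dim A < ennreal e" using assms by simp
  then show ?thesis
    unfolding hausdorff_dim_def Inf_less_iff using that by (auto simp: ennreal_less_iff)
qed

lemma packing_dim_eq_0D:
  assumes "packing_dim A = 0" "0 < e"
  obtains s where "0 < s" "s < e" "packing_measure s A = 0"
proof -
  have "packing_dim A < ennreal e" using assms by simp
  then show ?thesis
    unfolding packing_dim_def Inf_less_iff using that by (auto simp: ennreal_less_iff)
qed

lemma graph_of_subset_times_interval: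
  "\<exists>M\<ge>0. graph_of f \<subseteq> UNIV \<times> {-M..M}"
proof (intro exI conjI)
  have "\<bar>apply_bcontfun f x\<bar> \<le> norm f" for x
    using norm_bounded[of f x] by simp
  then show "graph_of f \<subseteq> UNIV \<times> {- norm f..norm f}"
    unfolding graph_of_def by (auto simp: abs_le_iff minus_le_iff)
qed simp

lemma hausdorff_dim_graph_le:
  assumes "hausdorff_dim (UNIV :: 'a::metric_space set) = 0"
  shows "hausdorff_dim (graph_of (f :: 'a \<Rightarrow>\<^sub>C real)) \<le> 1"
proof (rule ennreal_le_epsilon)
  fix e :: real
  assume "0 < e"
  \<comment> \<open>The product estimate is available for exponents up to 1.\<close>
  then have "0 < min e 1" by simp
  then obtain s where s: "0 < s" "s < min e 1" "hausdorff_measure s (UNIV :: 'a set) = 0"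
    by (rule hausdorff_dim_eq_0D[OF assms])
  obtain M where M: "0 \<le> M" "graph_of f \<subseteq> UNIV \<times> {-M..M}"
    using graph_of_subset_times_interval by blast
  have "hausdorff_measure (1 + s) (graph_of f) = 0"
    unfolding hausdorff_measure_eq_0_iff
  proof (intro allI impI)
    fix \<delta> :: real
    assume "0 < \<delta>"
    then have "hausdorff_pre (1 + s) \<delta> ((UNIV :: 'a set) \<times> {-M..M}) = 0"
      using hausdorff_measure_times_interval_eq_0[OF s(3,1) _ M(1)] s(2)
      unfolding hausdorff_measure_eq_0_iff by auto
    then show "hausdorff_pre (1 + s) \<delta> (graph_of f) = 0"
      using hausdorff_pre_mono[OF M(2) order_refl, of "1 + s" \<delta>] by simp
  qed
  then have "hausdorff_dim (graph_of f) \<le> ennreal (1 + s)"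
    unfolding hausdorff_dim_def using s by (intro Inf_lower CollectI exI[of _ "1 + s"] conjI refl) auto
  also have "\<dots> \<le> 1 + ennreal e"
    using s by (simp add: ennreal_plus ennreal_leI)
  finally show "hausdorff_dim (graph_of f) \<le> 1 + ennreal e" .
qed

lemma packing_dim_graph_le:
  assumes "packing_dim (UNIV :: 'a::metric_space set) = 0"
  shows "packing_dim (graph_of (f :: 'a \<Rightarrow>\<^sub>C real)) \<le> 1"
proof (rule ennreal_le_epsilon)
  fix e :: real
  assume "0 < e"
  then obtain s where s: "0 < s" "s < e" "packing_measure s (UNIV :: 'a set) = 0"
    by (rule packing_dim_eq_0D[OF assms])
  obtain M where M: "0 \<le> M" "graph_of f \<subseteq> UNIV \<times> {-M..M}"
    using graph_of_subset_times_interval by blast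
  have "packing_measure (1 + s) (graph_of f) = 0"
    using packing_measure_mono[OF M(2), of "1 + s"] packing_measure_times_interval_eq_0[OF s(3) M(1)]
    by simp
  then have "packing_dim (graph_of f) \<le> ennreal (1 + s)"
    unfolding packing_dim_def using s by (intro Inf_lower CollectI exI[of _ "1 + s"] conjI refl) auto
  also have "\<dots> \<le> 1 + ennreal e"
    using s by (simp add: ennreal_plus ennreal_leI)
  finally show "packing_dim (graph_of f) \<le> 1 + ennreal e" .
qed

text \<open>Vanishing of the measure passes to larger exponents, so a sequence of exponents
  increasing to 1 decides the matter.\<close>

lemma hausdorff_dim_ge_1:
  assumes "\<And>n::nat. hausdorff_measure (1 - 1 / (real n + 2)) A \<noteq> 0"
  shows "1 \<le> hausdorff_dim A"
  unfolding hausdorff_dim_def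
proof (rule Inf_greatest)
  fix d
  assume "d \<in> {ennreal s |s. 0 < s \<and> hausdorff_measure s A = 0}"
  then obtain s where s: "d = ennreal s" "0 < s" "hausdorff_measure s A = 0" by blast
  have "1 \<le> s"
  proof (rule ccontr)
    assume "\<not> 1 \<le> s"
    then have "0 < 1 - s" by simp
    then obtain n where n: "1 / Suc n < 1 - s" by (rule nat_approx_posE)
    have "1 / (real n + 2) \<le> 1 / Suc n" by (intro divide_left_mono) auto
    with n have "s \<le> 1 - 1 / (real n + 2)" by linarith
    with s(3) assms[of n] show False using hausdorff_measure_zero_mono by blast
  qed
  then show "1 \<le> d" using s(1) by (simp add: ennreal_leI flip: ennreal_1)
qed

section \<open>The energy of the probe, and prevalence\<close>

lemma riesz_energy_lebesgue_section:
  fixes \<phi> :: "'a::metric_space \<Rightarrow>\<^sub>C real"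
  assumes g [measurable]: "g \<in> borel_measurable borel" and right_inv: "\<And>u. u \<in> {0..<1} \<Longrightarrow> \<phi> (g u) = u"
    and s: "0 < s" "s < 1"
  defines "\<mu> \<equiv> distr (restrict_space lborel {0..<1}) borel g"
  shows "riesz_energy s \<mu> (apply_bcontfun \<phi>) < \<infinity>"
proof -
  define L where "L = restrict_space lborel {0..<1::real}"
  interpret L: prob_space L
    unfolding L_def by (rule prob_space_restrict_space) auto
  have g_L [measurable]: "g \<in> borel_measurable L"
    unfolding L_def by (rule measurable_restrict_space1) simp
  have \<mu>: "\<mu> = distr L borel g" by (simp add: \<mu>_def L_def)
  interpret \<mu>: prob_space \<mu>
    unfolding \<mu> by (rule L.prob_space_distr) simp
  have sets: "sets \<mu> = sets borel" by (simp add: \<mu>)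
  have \<phi>_borel [measurable]: "apply_bcontfun \<phi> \<in> borel_measurable borel"
    by (rule borel_measurable_continuous_onI) simp
  have \<phi>_meas [measurable]: "apply_bcontfun \<phi> \<in> borel_measurable \<mu>"
    unfolding measurable_cong_sets[OF sets refl] by (rule \<phi>_borel)
  have inner_meas [measurable]: "(\<lambda>x. \<integral>\<^sup>+y. riesz_kernel s (\<phi> x - \<phi> y) \<partial>\<mu>) \<in> borel_measurable borel"
    by (rule \<mu>.borel_measurable_nn_integral) measurable
  \<comment> \<open>Since \<open>\<phi> (g u) = u\<close>, both integrals pull back along
    \<open>g\<close> to the kernel of \<open>u - v\<close> on \<open>[0, 1)\<close>; the inner one
    is then bounded uniformly in \<open>u\<close>.\<close>
  have "riesz_energy s \<mu> (apply_bcontfun \<phi>) = (\<integral>\<^sup>+x. \<integral>\<^sup>+y. riesz_kernel s (\<phi> x - \<phi> y) \<partial>\<mu> \<partial>\<mu>)"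
    unfolding riesz_energy_def by (subst \<mu>.nn_integral_fst[symmetric]) simp_all
  also have "\<dots> = (\<integral>\<^sup>+u. \<integral>\<^sup>+y. riesz_kernel s (\<phi> (g u) - \<phi> y) \<partial>\<mu> \<partial>L)"
    using inner_meas by (subst (1) \<mu>) (rule nn_integral_distr, auto)
  also have "\<dots> \<le> (\<integral>\<^sup>+u. ennreal (2 / (1 - s) + 2) \<partial>L)"
  proof (rule nn_integral_mono)
    fix u
    assume "u \<in> space L"
    then have u: "u \<in> {0..<1}" by (simp add: L_def space_restrict_space)
    have "(\<integral>\<^sup>+y. riesz_kernel s (\<phi> (g u) - \<phi> y) \<partial>\<mu>) = (\<integral>\<^sup>+v. riesz_kernel s (\<phi> (g u) - \<phi> (g v)) \<partial>L)"
      unfolding \<mu> by (rule nn_integral_distr) measurable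
    also have "\<dots> = (\<integral>\<^sup>+v. riesz_kernel s (\<phi> (g u) - \<phi> (g v)) * indicator {0..<1} v \<partial>lborel)"
      unfolding L_def by (rule nn_integral_restrict_space) simp
    also have "\<dots> \<le> (\<integral>\<^sup>+v. riesz_kernel s (v - u) * indicator {-1..1} v \<partial>lborel)"
      using right_inv u riesz_kernel_minus[of s "u - _"]
      by (intro nn_integral_mono) (auto simp: indicator_def)
    also have "\<dots> \<le> ennreal (2 / (1 - s) + 2 * 1)"
      by (rule nn_integral_riesz_kernel_translate) (use s in auto)
    finally show "(\<integral>\<^sup>+y. riesz_kernel s (\<phi> (g u) - \<phi> y) \<partial>\<mu>) \<le> ennreal (2 / (1 - s) + 2)" by simp
  qed
  also have "\<dots> < \<infinity>" by (simp add: L.emeasure_space_1 del: ennreal_plus)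
  finally show ?thesis .
qed

lemma one_prevalent_hausdorff_dim_graph_ge_1:
  assumes "compact (UNIV :: 'a::metric_space set)" "uncountable (UNIV :: 'a set)"
  shows "one_prevalent {f :: 'a \<Rightarrow>\<^sub>C real. 1 \<le> hausdorff_dim (graph_of f)}"
proof -
  obtain \<phi> :: "'a \<Rightarrow>\<^sub>C real" and g :: "real \<Rightarrow> 'a"
    where g [measurable]: "g \<in> borel_measurable borel" and right_inv: "\<forall>u\<in>{0..<1}. \<phi> (g u) = u"
    by (rule continuous_function_with_borel_section[OF assms]) (rule that)
  define \<mu> where "\<mu> = distr (restrict_space lborel {0..<1}) borel g"
  have sets: "sets \<mu> = sets borel" by (simp add: \<mu>_def)
  have "prob_space (restrict_space lborel {0..<1::real})"
    by (rule prob_space_restrict_space) auto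
  then have \<mu>: "prob_space \<mu>"
    unfolding \<mu>_def by (rule prob_space.prob_space_distr) (rule measurable_restrict_space1, simp)
  interpret prob_space \<mu> by (rule \<mu>)
  have meas: "apply_bcontfun f \<in> borel_measurable \<mu>" for f :: "'a \<Rightarrow>\<^sub>C real"
    unfolding measurable_cong_sets[OF sets refl] by (rule borel_measurable_continuous_onI) simp
  \<comment> \<open>The \<open>+ 2\<close> keeps every exponent strictly between 0 and 1.\<close>
  define s where "s n = 1 - 1 / (real n + 2)" for n :: nat
  have s: "0 < s n" "s n < 1" for n by (auto simp: s_def)
  define B where "B = (\<Inter>n. {f :: 'a \<Rightarrow>\<^sub>C real. riesz_energy (s n) \<mu> (apply_bcontfun f) < \<infinity>})"
  have B: "B \<in> sets borel"
    unfolding B_def by (intro sets.countable_INT'' borel_finite_riesz_energy sets s) auto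
  have "1 \<le> hausdorff_dim (graph_of f)" if "f \<in> B" for f
  proof (rule hausdorff_dim_ge_1)
    fix n
    have "riesz_energy (s n) \<mu> (apply_bcontfun f) < \<infinity>" using that unfolding B_def by blast
    then show "hausdorff_measure (1 - 1 / (real n + 2)) (graph_of f) \<noteq> 0"
      using hausdorff_measure_graph_pos[OF \<mu> sets s(1)] unfolding s_def by blast
  qed
  then have B_subset: "B \<subseteq> {f. 1 \<le> hausdorff_dim (graph_of f)}" by blast
  have "emeasure (line_measure \<phi>) (UNIV - (\<lambda>x. x + y) ` B) = 0" for y
  proof -
    \<comment> \<open>The point \<open>t *\<^sub>R \<phi>\<close> lies in the translate of
      \<open>B\<close> by \<open>y\<close> exactly if \<open>- y + t *\<^sub>R \<phi>\<close> lies
      in \<open>B\<close>; so the energy estimate is applied to \<open>f = - y\<close>.\<close>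
    have "AE t in lborel. \<forall>n. riesz_energy (s n) \<mu> (\<lambda>x. (- y) x + t * \<phi> x) < \<infinity>"
      unfolding AE_all_countable
    proof
      fix n
      show "AE t in lborel. riesz_energy (s n) \<mu> (\<lambda>x. (- y) x + t * \<phi> x) < \<infinity>"
        using riesz_energy_lebesgue_section[OF g bspec[OF right_inv] s] unfolding \<mu>_def[symmetric]
        by (intro AE_finite_riesz_energy meas s sigma_finite_measure_axioms)
    qed
    then have AE: "AE t in lborel. t *\<^sub>R \<phi> \<in> (\<lambda>x. x + y) ` B"
    proof eventually_elim
      case (elim t)
      have "apply_bcontfun (- y + t *\<^sub>R \<phi>) = (\<lambda>x. (- y) x + t * \<phi> x)"
        by (auto simp: plus_bcontfun.rep_eq scaleR_bcontfun.rep_eq)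
      then have "- y + t *\<^sub>R \<phi> \<in> B" using elim by (simp add: B_def)
      then show ?case by (intro image_eqI[of _ _ "- y + t *\<^sub>R \<phi>"]) auto
    qed
    have [measurable]: "(\<lambda>t. t *\<^sub>R \<phi>) \<in> borel_measurable (lborel :: real measure)"
      unfolding measurable_lborel2 by (intro borel_measurable_continuous_onI continuous_intros)
    have B': "UNIV - (\<lambda>x. x + y) ` B \<in> sets borel"
      using translate_in_borel[OF B, of y] by (simp add: borel_comp flip: Compl_eq_Diff_UNIV)
    have "emeasure (line_measure \<phi>) (UNIV - (\<lambda>x. x + y) ` B)
        = emeasure lborel ((\<lambda>t. t *\<^sub>R \<phi>) -` (UNIV - (\<lambda>x. x + y) ` B) \<inter> space lborel)"
      unfolding line_measure_def by (rule emeasure_distr) (use B' in measurable)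
    also have "\<dots> = 0"
    proof -
      have "(\<lambda>t. t *\<^sub>R \<phi>) -` (UNIV - (\<lambda>x. x + y) ` B) \<inter> space lborel
          = {t \<in> space lborel. t *\<^sub>R \<phi> \<notin> (\<lambda>x. x + y) ` B}"
        by blast
      then show ?thesis using AE by (simp only:) (rule emeasure_eq_0_AE, simp)
    qed
    finally show ?thesis .
  qed
  moreover have "\<phi> \<noteq> 0"
    using bspec[OF right_inv, of "1/2"] by auto
  ultimately have "is_probe \<phi> B" by (simp add: is_probe_def)
  then have "\<exists>\<Phi>. is_probe \<Phi> B" ..
  with B B_subset show ?thesis unfolding one_prevalent_def by (intro bexI[of _ B] conjI)
qed

theorem corollary2p3:
  assumes "compact (UNIV :: 'a::metric_space set)"
    and "uncountable (UNIV :: 'a set)"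
    and "hausdorff_dim (UNIV :: 'a set) = 0"
  shows "one_prevalent {f :: 'a \<Rightarrow>\<^sub>C real. hausdorff_dim (graph_of f) = 1} \<and>
    (packing_dim (UNIV :: 'a set) = 0 \<longrightarrow>
      one_prevalent {f :: 'a \<Rightarrow>\<^sub>C real. hausdorff_dim (graph_of f) = 1 \<and> packing_dim (graph_of f) = 1})"
proof (intro conjI impI)
  have prevalent: "one_prevalent {f :: 'a \<Rightarrow>\<^sub>C real. 1 \<le> hausdorff_dim (graph_of f)}"
    using assms(1,2) by (rule one_prevalent_hausdorff_dim_graph_ge_1)
  have dim_H: "hausdorff_dim (graph_of f) = 1 \<longleftrightarrow> 1 \<le> hausdorff_dim (graph_of f)" for f :: "'a \<Rightarrow>\<^sub>C real"
    using hausdorff_dim_graph_le[OF assms(3), of f] by auto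
  show "one_prevalent {f :: 'a \<Rightarrow>\<^sub>C real. hausdorff_dim (graph_of f) = 1}"
    unfolding dim_H by (rule prevalent)
  assume "packing_dim (UNIV :: 'a set) = 0"
  then have "packing_dim (graph_of f) = 1" if "1 \<le> hausdorff_dim (graph_of f)" for f :: "'a \<Rightarrow>\<^sub>C real"
    using packing_dim_graph_le[of f] hausdorff_dim_le_packing_dim[of "graph_of f"] that
    by (intro antisym) (auto intro: order_trans)
  then have "{f :: 'a \<Rightarrow>\<^sub>C real. hausdorff_dim (graph_of f) = 1 \<and> packing_dim (graph_of f) = 1}
      = {f. 1 \<le> hausdorff_dim (graph_of f)}"
    unfolding dim_H by blast
  then show "one_prevalent {f :: 'a \<Rightarrow>\<^sub>C real. hausdorff_dim (graph_of f) = 1 \<and> packing_dim (graph_of f) = 1}"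
    using prevalent by simp
qed

end
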